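(* Let $k,n\in\mathbb{N}$ with $k\le n$. If $\varepsilon:\operatorname{V}(k,\mathbb{R}^n)\to\mathbb{R}^{n\times k}$ is an $\operatorname{SO}_n(\mathbb{R})$-equivariant embedding, then there is some $A\in\mathsf{S}^2_{++}(\mathbb{R}^k)$ such that $$\varepsilon(\operatorname{V}(k,\mathbb{R}^n))=\operatorname{V}_A(k,n).$$ If $n\ge 17$ and $k<(n-1)/2$, then $\operatorname{V}_A(k,n)$ has the lowest possible dimension ambient space among all possible $\operatorname{SO}_n(\mathbb{R})$-equivariant models of the Stiefel manifold.
   Context: $\operatorname{SO}_n(\mathbb{R})$ is the group of $n\times n$ real orthogonal matrices with determinant $1$. $\operatorname{V}(k,\mathbb{R}^n)$ is the Stiefel manifold of orthonormal $k$-frames $(w_1,\dots,w_k)$ in $\mathbb{R}^n$, on which $Q\in\operatorname{SO}_n(\mathbb{R})$ acts by $Q\cdot(w_1,\dots,w_k):=(Qw_1,\dots,Qw_k)$; $\operatorname{SO}_n(\mathbb{R})$ acts on $\mathbb{R}^{n\times k}$ by left multiplication $Q\cdot Y:=QY$. An $\operatorname{SO}_n(\mathbb{R})$-module is a real vector space $\mathbb{V}$ with a linear action of $\operatorname{SO}_n(\mathbb{R})$. An embedding $\varepsilon:\operatorname{V}(k,\mathbb{R}^n)\to\mathbb{V}$ into an $\operatorname{SO}_n(\mathbb{R})$-module is $\operatorname{SO}_n(\mathbb{R})$-equivariant if $\varepsilon(Q\cdot x)=Q\cdot\varepsilon(x)$ for all $Q\in\operatorname{SO}_n(\mathbb{R})$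 and $x\in\operatorname{V}(k,\mathbb{R}^n)$; its image is then called an $\operatorname{SO}_n(\mathbb{R})$-equivariant model of the Stiefel manifold, with ambient space $\mathbb{V}$. $\mathsf{S}^2_{++}(\mathbb{R}^k)$ is the set of $k\times k$ real symmetric positive definite matrices, and for $A\in\mathsf{S}^2_{++}(\mathbb{R}^k)$, $\operatorname{V}_A(k,n):=\{Y\in\mathbb{R}^{n\times k}:Y^{\mathsf T}Y=A\}$, whose ambient space is $\mathbb{R}^{n\times k}$.
   Formalization: Proved for k < n instead of k ≤ n: for k = n the first claim is false, since Q ↦ Q for det Q = 1 and Q ↦ 2Q for det Q = −1 is an equivariant embedding of V(n,R^n) whose image contains Y with YᵀY = I and Y with YᵀY = 4I, so it is no V_A(n,n). *)

theory Defs
  imports "HOL-Analysis.Analysis"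
begin

definition SO :: "(real^'n^'n) set" where
  "SO = {Q. rotation_matrix Q}"

text \<open>A \<open>k\<close>-frame \<open>(w\<^sub>1, \<dots>, w\<^sub>k)\<close> is the tuple \<open>w\<close> with entries \<open>w $ i\<close> in \<open>\<real>\<^sup>n\<close>, so frames
  have type \<^typ>\<open>real^'n^'k\<close>, whereas \<open>n \<times> k\<close> matrices have type \<^typ>\<open>real^'k^'n\<close>.\<close>

definition stiefel :: "(real^'n^'k) set" where
  "stiefel = {w. \<forall>i j. w $ i \<bullet> w $ j = (if i = j then 1 else 0)}"

definition frame_act :: "real^'n^'n \<Rightarrow> real^'n^'k \<Rightarrow> real^'n^'k" where
  "frame_act Q w = (\<chi> i. Q *v (w $ i))"

text \<open>A finite-dimensional module, on all of the type \<^typ>\<open>'v\<close>. Only the vector space structure of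
  \<^typ>\<open>'v\<close> and its canonical topology are used, never the inner product, and the action is not
  required to be continuous. Nothing is required of \<open>act Q\<close> for \<open>Q\<close> outside \<^term>\<open>SO\<close>.\<close>

definition SO_module :: "(real^'n^'n \<Rightarrow> 'v::euclidean_space \<Rightarrow> 'v) \<Rightarrow> bool" where
  "SO_module act \<longleftrightarrow>
     (\<forall>Q\<in>SO. linear (act Q)) \<and>
     (\<forall>v. act (mat 1) v = v) \<and>
     (\<forall>P\<in>SO. \<forall>Q\<in>SO. \<forall>v. act (P ** Q) v = act P (act Q v))"

text \<open>Embeddings are topological. Being equivariant on a homogeneous space, they are automatically
  smooth.\<close>

definition SO_equivariant_embedding ::
    "(real^'n^'n \<Rightarrow> 'v::euclidean_space \<Rightarrow> 'v) \<Rightarrow> (real^'n^'k \<Rightarrow> 'v) \<Rightarrow> bool" where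
  "SO_equivariant_embedding act \<epsilon> \<longleftrightarrow>
     SO_module act \<and>
     embedding_map (top_of_set stiefel) euclidean \<epsilon> \<and>
     (\<forall>Q\<in>SO. \<forall>w\<in>stiefel. \<epsilon> (frame_act Q w) = act Q (\<epsilon> w))"

text \<open>The first argument only serves to name the frame index type.\<close>

definition SO_equivariant_stiefel_model ::
    "'k::finite itself \<Rightarrow> (real^'n^'n \<Rightarrow> 'v::euclidean_space \<Rightarrow> 'v) \<Rightarrow> 'v set \<Rightarrow> bool" where
  "SO_equivariant_stiefel_model k act M \<longleftrightarrow>
     (\<exists>\<epsilon> :: real^'n^'k \<Rightarrow> 'v. SO_equivariant_embedding act \<epsilon> \<and> M = \<epsilon> ` stiefel)"

definition sym_pos_def :: "(real^'k^'k) set" where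
  "sym_pos_def = {A. transpose A = A \<and> (\<forall>x. x \<noteq> 0 \<longrightarrow> x \<bullet> (A *v x) > 0)}"

definition stiefel_model :: "real^'k^'k \<Rightarrow> (real^'k^'n) set" where
  "stiefel_model A = {Y. transpose Y ** Y = A}"

text \<open>For \<open>k = n\<close>, \<^const>\<open>stiefel\<close> consists of two \<^const>\<open>SO\<close>-orbits (determinant \<open>1\<close> and \<open>-1\<close>).
  Doubling the frames of negative orientation is then an equivariant embedding into the \<open>n \<times> n\<close>
  matrices whose image is not of the form \<^term>\<open>stiefel_model A\<close>, so the classification of
  equivariant embeddings needs \<open>k < n\<close>.\<close>

end

theory Submission
  imports Defs
begin

text \<open>For \<open>k < n\<close> the group \<^const>\<open>SO\<close> acts transitively on the orthonormal \<open>k\<close>-frames, so the image of an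
  equivariant embedding is the orbit of one vector.

  For an embedding into the \<open>n \<times> k\<close> matrices this vector is a matrix \<open>Y\<close>. The orbit of \<open>Y\<close> consists
  of all matrices with the same Gram matrix \<open>A = Y\<^sup>T Y\<close>. If \<open>Y\<close> had a kernel, there would be a half-turn
  that fixes \<open>Y\<close> and moves the frame (\<open>frame_not_fixed_by_stabilizer\<close>), which contradicts
  injectivity; hence \<open>A\<close> is positive definite. Conversely, if \<open>A = B\<^sup>T B\<close>, then \<open>w \<mapsto> w\<^sup>T B\<close>, with the frame
  vectors as rows of \<open>w\<close>, is an equivariant embedding onto \<^term>\<open>stiefel_model A\<close>.

  The lower bound says that in dimension below \<open>n k\<close> there is no room for an orbit of this type. The
  classical reason is that, for large \<open>n\<close> and up to isomorphism, the only irreducible continuous modules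
  of dimension below \<open>n (n - 1) / 2\<close> are the trivial one and \<open>\<real>\<^sup>n\<close>, and that a vector in a sum of
  trivial modules and fewer than \<open>k\<close> copies of \<open>\<real>\<^sup>n\<close> has too large a stabilizer. The proof below does
  not use highest weights, and the only continuity that it uses is the one of the embedding.

  \<^item> The diagonal sign matrices split the module into weight spaces indexed by sets of coordinates
    modulo complement. If a set with at least two elements and at least two non-elements occurs, so
    do all sets of its cardinality, and these give at least \<open>n choose 2\<close> different characters
    (\<open>large_weight_dimension\<close>). Below this dimension only the empty set and singletons occur. Stated
    without coordinates: \<open>(1 - h)(1 - h') = 0\<close> for half-turns \<open>h\<close>, \<open>h'\<close> in orthogonal planes
    (\<open>turns_degenerate\<close>).

  \<^item> This identity alone yields, for every direction \<open>a\<close>, an equivariant projection \<open>proj a\<close> of the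
    module onto the part on which the stabilizer of \<open>a\<close> acts trivially and half-turns that reverse \<open>a\<close>
    act as \<open>-1\<close>. Elements of \<^const>\<open>SO\<close> identify the ranges of these projections canonically with the
    range for one fixed unit vector \<open>p\<close> (\<open>line_space_stabilizer\<close>, \<open>transport_eq\<close>).

  \<^item> After this identification, projecting from direction \<open>a\<close> to direction \<open>b\<close> is an operator that
    depends only on \<open>t = a \<bullet> b\<close>. Rotating a plane shows that it is additive in \<open>t\<close>. On vectors with
    continuous orbit map, and the embedding provides such vectors, it is therefore multiplication by
    \<open>t\<close> (\<open>spherical_identity\<close>). Without continuity this would fail: a derivation of the reals
    is additive as well. It follows that the component of such a vector in direction \<open>a\<close> depends
    linearly on \<open>a\<close> (\<open>proj_orthonormal_combination\<close>).

  \<^item> Let \<open>v\<close> be the image of the frame \<open>w\<close>, and let \<open>y\<^sub>1, \<dots>, y\<^sub>k\<close> be its components in the directions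
    \<open>w\<^sub>1, \<dots>, w\<^sub>k\<close>, moved to the direction \<open>p\<close>. A linear relation between them would give a direction
    in the span of the frame in which \<open>v\<close> has no component, hence a half-turn that fixes \<open>v\<close> and
    moves \<open>w\<close>. So they are independent, and moving them to the \<open>n\<close> coordinate directions gives \<open>n k\<close>
    independent vectors (\<open>embedding_dimension_bound\<close>).\<close>

section \<open>Reflections and half-turns\<close>

definition reflection :: "real^'n \<Rightarrow> real^'n^'n" where
  "reflection m = matrix (\<lambda>x. x - (2 * (m \<bullet> x) / (m \<bullet> m)) *\<^sub>R m)"

lemma reflection_apply: "reflection m *v x = x - (2 * (m \<bullet> x) / (m \<bullet> m)) *\<^sub>R m"
proof -
  have "linear (\<lambda>x. x - (2 * (m \<bullet> x) / (m \<bullet> m)) *\<^sub>R m)"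
    by (rule linearI) (auto simp: algebra_simps add_divide_distrib)
  then show ?thesis
    by (simp add: reflection_def)
qed

lemma reflection_orthogonal_vector: "m \<bullet> x = 0 \<Longrightarrow> reflection m *v x = x"
  by (simp add: reflection_apply)

lemma reflection_self: "reflection m *v m = - m"
  by (cases "m = 0") (simp_all add: reflection_apply scaleR_2)

lemma reflection_involution: "reflection m ** reflection m = mat 1"
proof -
  have "reflection m *v (reflection m *v x) = x" for x
  proof (cases "m = 0")
    case False
    then have "m \<bullet> (reflection m *v x) = - (m \<bullet> x)"
      by (simp add: reflection_apply inner_diff_right)
    then show ?thesis
      by (simp add: reflection_apply [of m "reflection m *v x"]) (simp add: reflection_apply)
  qed (simp add: reflection_apply)
  then show ?thesis
    by (simp add: matrix_eq matrix_vector_mul_assoc [symmetric])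
qed

lemma orthogonal_matrix_inner:
  fixes Q :: "real^'n^'n"
  assumes "orthogonal_matrix Q"
  shows "(Q *v x) \<bullet> (Q *v y) = x \<bullet> y"
  using assms
  by (metis dot_lmul_matrix matrix_vector_mul_assoc matrix_vector_mul_lid orthogonal_matrix_def
      transpose_matrix_vector inner_commute)

lemma orthogonal_matrix_cancel:
  fixes Q :: "real^'n^'n"
  assumes "orthogonal_matrix Q"
  shows "transpose Q ** Q = mat 1" "Q ** transpose Q = mat 1"
    "transpose Q *v (Q *v x) = x" "Q *v (transpose Q *v x) = x"
proof -
  show "transpose Q ** Q = mat 1" "Q ** transpose Q = mat 1"
    using assms by (simp_all add: orthogonal_matrix_def)
  then show "transpose Q *v (Q *v x) = x" "Q *v (transpose Q *v x) = x"
    by (metis matrix_vector_mul_assoc matrix_vector_mul_lid)+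
qed

lemma orthogonal_reflection: "orthogonal_matrix (reflection m)"
proof -
  have "norm (reflection m *v x) = norm x" for x
  proof (cases "m = 0")
    case False
    have "(reflection m *v x) \<bullet> (reflection m *v x) = x \<bullet> x"
      using False
      by (simp add: reflection_apply inner_diff_right inner_diff_left inner_commute field_simps)
    then show ?thesis by (simp add: norm_eq_sqrt_inner)
  qed (simp add: reflection_apply)
  then show ?thesis
    using orthogonal_transformation_matrix [of "(*v) (reflection m)"]
    by (simp add: orthogonal_transformation)
qed

text \<open>Both the commutation of reflections in orthogonal mirrors and the equivariance of everything
  built from half-turns come from this relation.\<close>

lemma reflection_conjugate:
  assumes "orthogonal_matrix Q"
  shows "Q ** reflection m = reflection (Q *v m) ** Q"
proof -
  have "Q *v (reflection m *v x) = reflection (Q *v m) *v (Q *v x)" for x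
    using assms by (simp add: reflection_apply orthogonal_matrix_inner
        matrix_vector_mult_diff_distrib matrix_vector_mult_scaleR)
  then show ?thesis
    by (simp add: matrix_eq matrix_vector_mul_assoc [symmetric])
qed

lemma reflection_scaleR: "c \<noteq> 0 \<Longrightarrow> reflection (c *\<^sub>R m) = reflection m"
  by (simp add: matrix_eq reflection_apply field_simps)

lemma reflection_uminus: "reflection (- m) = reflection m"
  using reflection_scaleR [of "-1" m] by simp

lemma reflection_commute:
  assumes "a \<bullet> b = 0"
  shows "reflection a ** reflection b = reflection b ** reflection a"
  using reflection_conjugate [OF orthogonal_reflection, of a b]
  by (simp add: reflection_orthogonal_vector assms)

text \<open>Rotating the axis of the mirror to a coordinate axis makes the matrix diagonal.\<close>

lemma det_reflection:
  fixes m :: "real^'n"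
  assumes "m \<noteq> 0"
  shows "det (reflection m) = -1"
proof -
  fix k :: 'n
  obtain Q :: "real^'n^'n" where Q: "orthogonal_matrix Q" "Q *v axis k 1 = (1 / norm m) *\<^sub>R m"
    using orthogonal_matrix_exists_basis [of "(1 / norm m) *\<^sub>R m" k] assms by auto
  have "Q ** reflection (axis k 1) = reflection m ** Q"
    using reflection_conjugate [OF Q(1)] Q(2) assms by (simp add: reflection_scaleR)
  then have "det Q * det (reflection (axis k (1::real))) = det (reflection m) * det Q"
    by (metis det_mul)
  moreover have "det Q \<noteq> 0"
    using det_orthogonal_matrix [OF Q(1)] by auto
  moreover have "det (reflection (axis k (1::real))) = -1"
  proof -
    have diag: "reflection (axis k (1::real)) $ i $ j = (if i = j then if i = k then -1 else 1 else 0)"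
      for i j
      by (auto simp: reflection_def matrix_def inner_axis_axis) (auto simp: axis_def)
    then have "det (reflection (axis k (1::real)))
        = prod (\<lambda>i. reflection (axis k (1::real)) $ i $ i) UNIV"
      by (intro det_diagonal) auto
    also have "\<dots> = prod (\<lambda>i. if i = k then -1 else 1 :: real) UNIV"
      by (simp add: diag)
    finally show ?thesis by simp
  qed
  ultimately have "det (reflection m) * det Q = (-1) * det Q" by simp
  with \<open>det Q \<noteq> 0\<close> show ?thesis by (metis mult_right_cancel)
qed

lemma SO_iff: "Q \<in> SO \<longleftrightarrow> orthogonal_matrix Q \<and> det Q = 1"
  by (simp add: SO_def rotation_matrix_def)

lemma SO_orthogonal: "Q \<in> SO \<Longrightarrow> orthogonal_matrix Q"
  by (simp add: SO_iff)

lemma SO_mul: "P \<in> SO \<Longrightarrow> Q \<in> SO \<Longrightarrow> P ** Q \<in> SO"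
  by (simp add: SO_iff orthogonal_matrix_mul det_mul)

lemma SO_transpose: "Q \<in> SO \<Longrightarrow> transpose Q \<in> SO"
  by (simp add: SO_iff orthogonal_matrix_transpose)

lemma SO_one: "mat 1 \<in> SO"
  by (simp add: SO_iff orthogonal_matrix_id)

abbreviation half_turn :: "real^'n \<Rightarrow> real^'n \<Rightarrow> real^'n^'n" where
  "half_turn a b \<equiv> reflection a ** reflection b"

lemma half_turn_SO: "a \<noteq> 0 \<Longrightarrow> b \<noteq> 0 \<Longrightarrow> half_turn a b \<in> SO"
  by (simp add: SO_iff orthogonal_matrix_mul orthogonal_reflection det_mul det_reflection)

lemma unit_nonzero: "a \<bullet> a = 1 \<Longrightarrow> a \<noteq> (0::real^'n)"
  by auto

lemma inner_unit_bound:
  fixes a b :: "real^'n"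
  assumes "a \<bullet> a = 1" "b \<bullet> b = 1"
  shows "\<bar>a \<bullet> b\<bar> \<le> 1"
  using Cauchy_Schwarz_ineq2 [of a b] assms by (simp add: norm_eq_sqrt_inner)

lemma orthogonal_vector_exists:
  fixes S :: "(real^'n) set"
  assumes "finite S" "card S < CARD('n)"
  shows "\<exists>c. norm c = 1 \<and> (\<forall>x\<in>S. x \<bullet> c = 0)"
proof -
  have "dim S < DIM(real^'n)"
    using dim_le_card' [OF assms(1)] assms(2) by simp
  then obtain c where c: "c \<noteq> 0" "\<And>x. x \<in> span S \<Longrightarrow> orthogonal c x"
    using orthogonal_to_subspace_exists by blast
  show ?thesis
  proof (intro exI conjI ballI)
    show "x \<bullet> (1 / norm c) *\<^sub>R c = 0" if "x \<in> S" for x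
      using c(2) [OF span_base [OF that]] by (simp add: orthogonal_def inner_commute)
  qed (use c in auto)
qed

text \<open>Products of reflections whose mirrors contain \<open>u\<close>. The vector \<open>u = 0\<close> imposes no restriction, which
  lets one induction serve both for transitivity on families of vectors and for generating the
  stabilizer of a vector.\<close>

inductive_set reflection_products :: "real^'n \<Rightarrow> (real^'n^'n) set" for u :: "real^'n" where
  one: "mat 1 \<in> reflection_products u"
| step: "g \<in> reflection_products u \<Longrightarrow> m \<noteq> 0 \<Longrightarrow> m \<bullet> u = 0 \<Longrightarrow> reflection m ** g \<in> reflection_products u"

lemma reflection_products_orthogonal:
  "g \<in> reflection_products u \<Longrightarrow> orthogonal_matrix g"
  by (induction rule: reflection_products.induct)
    (auto simp: orthogonal_matrix_id orthogonal_matrix_mul orthogonal_reflection)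

lemma reflection_products_fix: "g \<in> reflection_products u \<Longrightarrow> g *v u = u"
  by (induction rule: reflection_products.induct)
    (auto simp: matrix_vector_mul_assoc [symmetric] reflection_orthogonal_vector)

text \<open>The vectors are moved into place one at a time. The mirror between the image of the next
  vector and its target contains all targets reached before, because the inner products agree.\<close>

lemma reflection_products_transport:
  fixes w w' :: "'i \<Rightarrow> real^'n"
  assumes "finite I"
    and "\<And>i j. i \<in> I \<Longrightarrow> j \<in> I \<Longrightarrow> w i \<bullet> w j = w' i \<bullet> w' j"
    and "\<And>i. i \<in> I \<Longrightarrow> w i \<bullet> u = w' i \<bullet> u"
  shows "\<exists>g\<in>reflection_products u. \<forall>i\<in>I. g *v w i = w' i"
  using assms
proof (induction I rule: finite_induct)
  case empty
  then show ?case using reflection_products.one by auto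
next
  case (insert j I)
  then obtain g where g: "g \<in> reflection_products u" "\<And>i. i \<in> I \<Longrightarrow> g *v w i = w' i"
    by (metis insertCI)
  note inner_g = orthogonal_matrix_inner [OF reflection_products_orthogonal [OF g(1)]]
  define m where "m = g *v w j - w' j"
  show ?case
  proof (cases "m = 0")
    case True
    then show ?thesis using g by (auto simp: m_def)
  next
    case False
    have "m \<bullet> u = 0"
      using inner_g [of "w j" u] insert.prems(2)
      by (simp add: m_def inner_diff_left reflection_products_fix [OF g(1)])
    then have "reflection m ** g \<in> reflection_products u"
      using g(1) False by (intro reflection_products.step)
    moreover have "(reflection m ** g) *v w i = w' i" if "i \<in> I" for i
    proof -
      have "m \<bullet> w' i = 0"
        using inner_g [of "w j" "w i"] g(2) [OF that] insert.prems(1) that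
        by (simp add: m_def inner_diff_left)
      then show ?thesis
        by (simp add: matrix_vector_mul_assoc [symmetric] g(2) [OF that] reflection_orthogonal_vector)
    qed
    moreover have "(reflection m ** g) *v w j = w' j"
    proof -
      have "m \<bullet> m = 2 * (m \<bullet> (g *v w j))"
        using inner_g [of "w j" "w j"] insert.prems(1)
        by (simp add: m_def inner_diff_left inner_diff_right inner_commute)
      then have coeff: "2 * (m \<bullet> (g *v w j)) / (m \<bullet> m) = 1"
        using False by (metis divide_self inner_eq_zero_iff)
      have "(reflection m ** g) *v w j = g *v w j - 1 *\<^sub>R m"
        by (simp only: matrix_vector_mul_assoc [symmetric] reflection_apply coeff)
      then show ?thesis
        by (simp add: m_def)
    qed
    ultimately show ?thesis by blast
  qed
qed

text \<open>A product of reflections with the wrong determinant is corrected by a reflection that fixes all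
  targets; the bound on the number of vectors makes room for its axis.\<close>

lemma SO_transport:
  fixes w w' :: "'i \<Rightarrow> real^'n"
  assumes "finite I" "card I < CARD('n)"
    and gram: "\<And>i j. i \<in> I \<Longrightarrow> j \<in> I \<Longrightarrow> w i \<bullet> w j = w' i \<bullet> w' j"
  obtains Q where "Q \<in> SO" "\<And>i. i \<in> I \<Longrightarrow> Q *v w i = w' i"
proof -
  obtain g where g: "g \<in> reflection_products 0" "\<And>i. i \<in> I \<Longrightarrow> g *v w i = w' i"
    using reflection_products_transport [of I w w' 0] assms by auto
  have orth: "orthogonal_matrix g"
    using g(1) by (rule reflection_products_orthogonal)
  show ?thesis
  proof (cases "det g = 1")
    case True
    then show ?thesis using that [of g] g(2) orth by (simp add: SO_iff)
  next
    case False
    have "card (w' ` I) < CARD('n)"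
      using assms(1,2) card_image_le le_less_trans by blast
    then obtain c where c: "norm c = 1" "\<And>x. x \<in> w' ` I \<Longrightarrow> x \<bullet> c = 0"
      using orthogonal_vector_exists [of "w' ` I"] assms(1) by blast
    show ?thesis
    proof (rule that [of "reflection c ** g"])
      have "det g = -1" "c \<noteq> 0"
        using False det_orthogonal_matrix [OF orth] c(1) by auto
      then show "reflection c ** g \<in> SO"
        using orth
        by (auto simp: SO_iff orthogonal_matrix_mul orthogonal_reflection det_mul det_reflection)
      show "(reflection c ** g) *v w i = w' i" if "i \<in> I" for i
        using g(2) [OF that] c(2) [of "w' i"] that
        by (simp add: matrix_vector_mul_assoc [symmetric] reflection_orthogonal_vector inner_commute)
    qed
  qed
qed

section \<open>Equivariant embeddings into the matrix space\<close>

lemma transpose_mul_nth: "(transpose Y ** Y) $ i $ j = column i Y \<bullet> column j Y"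
  for Y :: "real^'k^'n"
  by (simp add: matrix_matrix_mult_def transpose_def column_def inner_vec_def)

lemma column_mul: "column i (Q ** Y) = Q *v column i Y"
  for Q :: "real^'n^'m"
  by (simp add: vec_eq_iff column_def matrix_matrix_mult_def matrix_vector_mult_def)

lemma matrix_eq_columns: "(\<And>i. column i X = column i Y) \<Longrightarrow> X = Y"
  by (simp add: vec_eq_iff column_def)

lemma same_gram_SO_orbit:
  fixes X Y :: "real^'k^'n"
  assumes "CARD('k) < CARD('n)" "transpose X ** X = transpose Y ** Y"
  obtains Q where "Q \<in> SO" "Q ** X = Y"
proof -
  have "column i X \<bullet> column j X = column i Y \<bullet> column j Y" for i j
    using assms(2) by (metis transpose_mul_nth)
  then obtain Q where "Q \<in> SO" "\<And>i. Q *v column i X = column i Y"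
    using SO_transport [of UNIV "\<lambda>i. column i X" "\<lambda>i. column i Y"] assms(1) by auto
  then show ?thesis
    using that [of Q] by (metis column_mul matrix_eq_columns)
qed

lemma SO_transitive_stiefel:
  fixes w w' :: "real^'n^'k"
  assumes "CARD('k) < CARD('n)" "w \<in> stiefel" "w' \<in> stiefel"
  obtains Q where "Q \<in> SO" "frame_act Q w = w'"
proof -
  obtain Q where "Q \<in> SO" "\<And>i. Q *v (w $ i) = w' $ i"
    using SO_transport [of UNIV "\<lambda>i. w $ i" "\<lambda>i. w' $ i"] assms by (auto simp: stiefel_def)
  then show ?thesis
    using that [of Q] by (simp add: frame_act_def vec_eq_iff)
qed

lemma frame_act_stiefel: "Q \<in> SO \<Longrightarrow> w \<in> stiefel \<Longrightarrow> frame_act Q w \<in> stiefel"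
  by (simp add: stiefel_def frame_act_def orthogonal_matrix_inner SO_orthogonal)

lemma stiefel_nonempty:
  assumes "CARD('k) < CARD('n)"
  shows "(stiefel :: (real^'n^'k) set) \<noteq> {}"
proof -
  obtain f :: "'k \<Rightarrow> 'n" where f: "inj f"
    using assms card_le_inj [of "UNIV :: 'k set" "UNIV :: 'n set"] by auto
  have "(\<chi> i. axis (f i) 1) \<in> (stiefel :: (real^'n^'k) set)"
    using f by (auto simp: stiefel_def inner_axis_axis inj_eq)
  then show ?thesis by blast
qed

text \<open>If the matrix has a kernel, its columns span a space of dimension below that of the frame, so
  some vector \<open>u\<close> in the span of the frame is orthogonal to all columns; a second vector \<open>v\<close> is
  orthogonal to the columns and to \<open>u\<close>. The half-turn in the plane of \<open>u\<close> and \<open>v\<close> fixes the matrix,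
  but not the frame.\<close>

lemma frame_not_fixed_by_stabilizer:
  fixes w :: "real^'n^'k" and Y :: "real^'k^'n"
  assumes "CARD('k) < CARD('n)" "w \<in> stiefel" "Y *v x = 0" "x \<noteq> 0"
  obtains Q where "Q \<in> SO" "Q ** Y = Y" "frame_act Q w \<noteq> w"
proof -
  \<comment> \<open>The kernel of \<open>N\<close> parametrizes the vectors in the span of the frame that are orthogonal to the
    columns of \<open>Y\<close>. The matrix \<open>N\<close> is square, and its transpose has the kernel vector \<open>x\<close>.\<close>
  define N where "N = transpose Y ** transpose w"
  have "transpose N *v x = 0"
    using assms(3) by (simp add: N_def matrix_transpose_mul matrix_vector_mul_assoc [symmetric]
        del: transpose_matrix_vector)
  then have "\<not> invertible (transpose N)"
    using assms(4) matrix_left_invertible_ker [of "transpose N"] by (auto simp: invertible_left_inverse)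
  then have "\<not> invertible N"
    by (simp add: invertible_det_nz)
  then obtain z where z: "N *v z = 0" "z \<noteq> 0"
    using matrix_left_invertible_ker [of N] by (auto simp: invertible_left_inverse)
  define u where "u = transpose w *v z"
  have u_sum: "u = (\<Sum>i\<in>UNIV. z $ i *\<^sub>R w $ i)"
    unfolding u_def
    by (simp add: matrix_mult_sum column_transpose row_def scalar_mult_eq_scaleR vec_nth_inverse)
  have w_u: "w $ i \<bullet> u = z $ i" for i
  proof -
    have "w $ i \<bullet> u = (\<Sum>l\<in>UNIV. z $ l * (w $ i \<bullet> w $ l))"
      by (simp add: u_sum inner_sum_right)
    also have "\<dots> = (\<Sum>l\<in>UNIV. if l = i then z $ i else 0)"
      using assms(2) by (intro sum.cong) (auto simp: stiefel_def)
    finally show ?thesis by simp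
  qed
  have u0: "u \<noteq> 0"
  proof
    assume "u = 0"
    then have "z $ i = 0" for i
      using w_u [of i] by simp
    then show False
      using z(2) by (simp add: vec_eq_iff)
  qed
  have "transpose Y *v u = 0"
    using z(1) by (simp add: N_def u_def matrix_vector_mul_assoc del: transpose_matrix_vector)
  moreover have "column i Y \<bullet> u = (transpose Y *v u) $ i" for i
    by (simp add: matrix_vector_mult_def transpose_def column_def inner_vec_def del: transpose_matrix_vector)
  ultimately have col_u: "column i Y \<bullet> u = 0" for i
    by simp
  obtain j where j: "x $ j \<noteq> 0"
    using assms(4) by (metis vec_eq_iff zero_index)
  \<comment> \<open>Column \<open>j\<close> is a combination of the others. Leaving it out keeps the number of conditions on \<open>v\<close>
    at \<open>k\<close>, which matters when \<open>k = n - 1\<close>.\<close>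
  define S where "S = insert u ((\<lambda>i. column i Y) ` (UNIV - {j}))"
  have "card S \<le> Suc (card ((\<lambda>i. column i Y) ` (UNIV - {j})))"
    by (simp add: S_def card_insert_if)
  also have "\<dots> \<le> Suc (CARD('k) - 1)"
    using card_image_le [of "UNIV - {j}" "\<lambda>i. column i Y"]
    by (simp only: Suc_le_mono) (simp add: card_Diff_singleton)
  also have "\<dots> < CARD('n)"
    using assms(1) by simp
  finally obtain v where v: "norm v = 1" "\<And>y. y \<in> S \<Longrightarrow> y \<bullet> v = 0"
    using orthogonal_vector_exists [of S] by (auto simp: S_def)
  have uv: "u \<bullet> v = 0"
    using v(2) by (simp add: S_def)
  have v0: "v \<noteq> 0"
    using v(1) by auto
  have "0 = (\<Sum>i\<in>UNIV. x $ i *\<^sub>R column i Y) \<bullet> v"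
    using assms(3) by (simp add: matrix_mult_sum scalar_mult_eq_scaleR)
  also have "\<dots> = (\<Sum>i\<in>UNIV. x $ i * (column i Y \<bullet> v))"
    by (simp add: inner_sum_left)
  also have "\<dots> = (\<Sum>i\<in>UNIV. if i = j then x $ j * (column j Y \<bullet> v) else 0)"
    using v(2) by (intro sum.cong) (auto simp: S_def)
  finally have "column j Y \<bullet> v = 0"
    using j by simp
  then have col_v: "column i Y \<bullet> v = 0" for i
    using v(2) by (cases "i = j") (auto simp: S_def)
  show ?thesis
  proof (rule that)
    show "half_turn u v \<in> SO"
      using u0 v0 by (rule half_turn_SO)
    show "half_turn u v ** Y = Y"
      by (rule matrix_eq_columns)
        (simp add: column_mul matrix_vector_mul_assoc [symmetric] reflection_orthogonal_vector
          col_u col_v inner_commute [of _ "column _ _"])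
    show "frame_act (half_turn u v) w \<noteq> w"
    proof
      assume fix_w: "frame_act (half_turn u v) w = w"
      have "z $ i = 0" for i
      proof -
        have "half_turn u v *v (w $ i) = w $ i"
          using fix_w by (simp add: frame_act_def vec_eq_iff)
        then have "(half_turn u v *v (w $ i)) \<bullet> (half_turn u v *v u) = - (w $ i \<bullet> u)"
          using uv by (simp add: matrix_vector_mul_assoc [symmetric] reflection_orthogonal_vector
              inner_commute [of v u] reflection_self)
        moreover have "(half_turn u v *v (w $ i)) \<bullet> (half_turn u v *v u) = w $ i \<bullet> u"
          by (intro orthogonal_matrix_inner orthogonal_matrix_mul orthogonal_reflection)
        ultimately show ?thesis by (simp add: w_u)
      qed
      then show False using z(2) by (simp add: vec_eq_iff)
    qed
  qed
qed

lemma embedding_inj: "SO_equivariant_embedding act \<epsilon> \<Longrightarrow> inj_on \<epsilon> stiefel"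
  unfolding SO_equivariant_embedding_def embedding_map_def
  using homeomorphic_imp_injective_map by fastforce

lemma embedding_continuous: "SO_equivariant_embedding act \<epsilon> \<Longrightarrow> continuous_on stiefel \<epsilon>"
  unfolding SO_equivariant_embedding_def embedding_map_def
  by (metis continuous_map_into_fulltopology continuous_map_iff_continuous homeomorphic_imp_continuous_map)

text \<open>Injectivity forces the image of a frame to have full column rank, so its Gram matrix is positive
  definite. The image is one orbit, and an orbit in the matrix space is a fibre of the Gram map.\<close>

lemma equivariant_image:
  fixes \<epsilon> :: "real^'n^'k \<Rightarrow> real^'k^'n"
  assumes card: "CARD('k) < CARD('n)" and emb: "SO_equivariant_embedding (**) \<epsilon>"
  shows "\<exists>A\<in>sym_pos_def. \<epsilon> ` stiefel = stiefel_model A"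
proof -
  have equi: "\<epsilon> (frame_act Q w) = Q ** \<epsilon> w" if "Q \<in> SO" "w \<in> stiefel" for Q w
    using emb that by (simp add: SO_equivariant_embedding_def)
  obtain w :: "real^'n^'k" where w: "w \<in> stiefel"
    using stiefel_nonempty [OF card] by blast
  define A where "A = transpose (\<epsilon> w) ** \<epsilon> w"
  have "A \<in> sym_pos_def"
    unfolding sym_pos_def_def
  proof (intro CollectI conjI allI impI)
    show "transpose A = A"
      by (simp add: A_def matrix_transpose_mul)
    fix x :: "real^'k"
    assume "x \<noteq> 0"
    have "\<epsilon> w *v x \<noteq> 0"
    proof
      assume "\<epsilon> w *v x = 0"
      then obtain Q where Q: "Q \<in> SO" "Q ** \<epsilon> w = \<epsilon> w" "frame_act Q w \<noteq> w"
        using frame_not_fixed_by_stabilizer [OF card w _ \<open>x \<noteq> 0\<close>] by blast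
      have "\<epsilon> (frame_act Q w) = \<epsilon> w"
        using equi Q w by simp
      then show False
        using inj_onD [OF embedding_inj [OF emb]] Q frame_act_stiefel [OF Q(1) w] w by blast
    qed
    moreover have "x \<bullet> (A *v x) = (\<epsilon> w *v x) \<bullet> (\<epsilon> w *v x)"
      using dot_lmul_matrix [of "\<epsilon> w *v x" "\<epsilon> w" x]
      by (simp add: A_def matrix_vector_mul_assoc [symmetric] inner_commute)
    ultimately show "x \<bullet> (A *v x) > 0"
      by simp
  qed
  moreover have "\<epsilon> ` stiefel = stiefel_model A"
  proof (intro equalityI subsetI)
    fix Y assume "Y \<in> \<epsilon> ` stiefel"
    then obtain w' where w': "w' \<in> stiefel" "Y = \<epsilon> w'" by blast
    obtain Q where Q: "Q \<in> SO" "frame_act Q w = w'"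
      using SO_transitive_stiefel [OF card w w'(1)] by blast
    have "Y = Q ** \<epsilon> w"
      using equi [OF Q(1) w] Q w' by simp
    then have "transpose Y ** Y = transpose (\<epsilon> w) ** (transpose Q ** Q) ** \<epsilon> w"
      by (simp add: matrix_transpose_mul matrix_mul_assoc)
    then show "Y \<in> stiefel_model A"
      by (simp add: stiefel_model_def A_def orthogonal_matrix_cancel SO_orthogonal Q)
  next
    fix Y :: "real^'k^'n" assume "Y \<in> stiefel_model A"
    then obtain Q where Q: "Q \<in> SO" "Q ** \<epsilon> w = Y"
      using same_gram_SO_orbit [OF card, where X = "\<epsilon> w" and Y = Y]
      by (auto simp: stiefel_model_def A_def)
    then show "Y \<in> \<epsilon> ` stiefel"
      using equi [OF Q(1) w] frame_act_stiefel [OF Q(1) w] by (metis image_eqI)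
  qed
  ultimately show ?thesis by blast
qed

section \<open>The models given by positive definite matrices\<close>

text \<open>Gram-Schmidt for the inner product of a positive definite matrix: the next vector is taken
  orthogonal, in the standard sense, to the images of the earlier ones.\<close>

lemma pos_def_orthonormal_family:
  fixes A :: "real^'k^'k"
  assumes A: "A \<in> sym_pos_def" and "finite (I :: 'k set)"
  shows "\<exists>c. \<forall>i\<in>I. \<forall>j\<in>I. c i \<bullet> (A *v c j) = (if i = j then 1 else 0)"
  using assms(2)
proof (induction I rule: finite_induct)
  case empty
  then show ?case by simp
next
  case (insert j I)
  then obtain c where c: "\<forall>i\<in>I. \<forall>l\<in>I. c i \<bullet> (A *v c l) = (if i = l then 1 else 0)" by blast
  have sym: "x \<bullet> (A *v y) = y \<bullet> (A *v x)" for x y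
    using A dot_lmul_matrix [of x A y] transpose_matrix_vector [of A x]
    by (simp add: sym_pos_def_def inner_commute)
  have "card ((\<lambda>i. A *v c i) ` I) < CARD('k)"
  proof -
    have "I \<subset> UNIV"
      using insert.hyps(2) by auto
    then show ?thesis
      using card_image_le [OF insert.hyps(1), of "\<lambda>i. A *v c i"] psubset_card_mono [of UNIV I]
      by simp
  qed
  then obtain x where x: "norm x = 1" "\<And>y. y \<in> (\<lambda>i. A *v c i) ` I \<Longrightarrow> y \<bullet> x = 0"
    using orthogonal_vector_exists [of "(\<lambda>i. A *v c i) ` I"] insert.hyps(1) by blast
  have pos: "x \<bullet> (A *v x) > 0"
  proof -
    have "x \<noteq> 0" using x(1) by auto
    then show ?thesis using A by (simp add: sym_pos_def_def)
  qed
  define d where "d = c(j := (1 / sqrt (x \<bullet> (A *v x))) *\<^sub>R x)"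
  have "d j \<bullet> (A *v d j) = 1"
    using pos by (simp add: d_def matrix_vector_mult_scaleR)
  moreover have "d i \<bullet> (A *v d j) = 0" "d j \<bullet> (A *v d i) = 0" if "i \<in> I" for i
  proof -
    have "x \<bullet> (A *v c i) = 0"
      using x(2) [of "A *v c i"] that by (simp add: inner_commute)
    then show "d i \<bullet> (A *v d j) = 0" "d j \<bullet> (A *v d i) = 0"
      using that insert.hyps(2) sym [of "c i" x] by (auto simp: d_def matrix_vector_mult_scaleR)
  qed
  moreover have "d i \<bullet> (A *v d l) = (if i = l then 1 else 0)" if "i \<in> I" "l \<in> I" for i l
    using that insert.hyps(2) c by (auto simp: d_def)
  ultimately have "\<forall>i\<in>insert j I. \<forall>l\<in>insert j I. d i \<bullet> (A *v d l) = (if i = l then 1 else 0)"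
    using insert.hyps(2) by auto
  then show ?case by blast
qed

text \<open>The columns of \<open>C\<close> are an orthonormal basis for the inner product given by \<open>A\<close>, and \<open>B\<close> is the
  inverse of \<open>C\<close>.\<close>

lemma pos_def_factorization:
  fixes A :: "real^'k^'k"
  assumes "A \<in> sym_pos_def"
  obtains B C :: "real^'k^'k" where "transpose B ** B = A" "B ** C = mat 1" "C ** B = mat 1"
proof -
  obtain c :: "'k \<Rightarrow> real^'k" where c: "\<And>i j. c i \<bullet> (A *v c j) = (if i = j then 1 else 0)"
    using pos_def_orthonormal_family [OF assms, of UNIV] by auto
  define C where "C = transpose (\<chi> i. c i)"
  have "(transpose C ** (A ** C)) $ i $ j = c i \<bullet> (A *v c j)" for i j
    by (simp add: C_def transpose_def matrix_matrix_mult_def matrix_vector_mult_def inner_vec_def)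
  then have 1: "transpose C ** (A ** C) = mat 1"
    by (simp add: vec_eq_iff mat_def c)
  define B where "B = transpose C ** A"
  have BC: "B ** C = mat 1"
    using 1 by (simp add: B_def matrix_mul_assoc)
  then have CB: "C ** B = mat 1"
    by (simp add: matrix_left_right_inverse)
  have "transpose B ** B = transpose B ** transpose C ** A"
    by (simp add: B_def matrix_mul_assoc)
  also have "transpose B ** transpose C = mat 1"
    using CB by (simp add: matrix_transpose_mul [symmetric])
  finally show ?thesis
    using that [of B C] BC CB by simp
qed

lemma stiefel_iff: "w \<in> stiefel \<longleftrightarrow> w ** transpose w = mat 1"
  for w :: "real^'n^'k"
  by (simp add: stiefel_def vec_eq_iff matrix_matrix_mult_def transpose_def inner_vec_def mat_def)

lemma stiefel_model_is_model:
  fixes A :: "real^'k^'k"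
  assumes "A \<in> sym_pos_def"
  shows "SO_equivariant_stiefel_model TYPE('k)
    ((**) :: real^'n^'n \<Rightarrow> real^'k^'n \<Rightarrow> real^'k^'n) (stiefel_model A)"
proof -
  obtain B C :: "real^'k^'k" where BC: "transpose B ** B = A" "B ** C = mat 1" "C ** B = mat 1"
    by (rule pos_def_factorization [OF assms])
  define \<epsilon> :: "real^'n^'k \<Rightarrow> real^'k^'n" where "\<epsilon> w = transpose w ** B" for w
  define \<delta> :: "real^'k^'n \<Rightarrow> real^'n^'k" where "\<delta> Y = transpose (Y ** C)" for Y
  have inv: "\<delta> (\<epsilon> w) = w" "\<epsilon> (\<delta> Y) = Y" for w Y
    by (simp_all add: \<epsilon>_def \<delta>_def matrix_mul_assoc [symmetric] BC)
  have cont: "continuous_on S \<epsilon>" "continuous_on T \<delta>" for S T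
    unfolding \<epsilon>_def \<delta>_def transpose_def matrix_matrix_mult_def
    by (intro continuous_intros)+
  have image: "\<epsilon> ` stiefel = stiefel_model A"
  proof (intro equalityI subsetI)
    fix Y assume "Y \<in> \<epsilon> ` stiefel"
    then obtain w where w: "w ** transpose w = mat 1" "Y = \<epsilon> w"
      by (auto simp: stiefel_iff)
    have "transpose Y ** Y = transpose B ** (w ** transpose w) ** B"
      unfolding w(2) by (simp only: \<epsilon>_def matrix_transpose_mul matrix_mul_assoc transpose_transpose)
    then show "Y \<in> stiefel_model A"
      by (simp add: stiefel_model_def w(1) BC)
  next
    fix Y :: "real^'k^'n" assume "Y \<in> stiefel_model A"
    then have YY: "transpose Y ** Y = transpose B ** B"
      by (simp add: stiefel_model_def BC)
    have "\<delta> Y ** transpose (\<delta> Y) = transpose C ** (transpose Y ** Y) ** C"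
      by (simp add: \<delta>_def matrix_transpose_mul matrix_mul_assoc)
    also have "\<dots> = (transpose C ** transpose B) ** (B ** C)"
      by (simp add: YY matrix_mul_assoc)
    also have "\<dots> = mat 1"
      using BC(2) by (simp add: matrix_transpose_mul [symmetric])
    finally have "\<delta> Y \<in> stiefel" by (simp add: stiefel_iff)
    then show "Y \<in> \<epsilon> ` stiefel" by (metis inv(2) image_eqI)
  qed
  have "homeomorphic_maps (top_of_set stiefel) (top_of_set (\<epsilon> ` stiefel)) \<epsilon> \<delta>"
    unfolding homeomorphic_maps_def using cont inv
    by (auto simp: continuous_map_in_subtopology)
  then have "embedding_map (top_of_set stiefel) euclidean \<epsilon>"
    unfolding embedding_map_def homeomorphic_map_maps by auto
  moreover have "SO_module ((**) :: real^'n^'n \<Rightarrow> real^'k^'n \<Rightarrow> real^'k^'n)"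
    unfolding SO_module_def
    by (auto intro!: linearI simp: matrix_add_ldistrib matrix_mul_assoc)
      (simp add: vec_eq_iff matrix_matrix_mult_def sum_distrib_left mult.left_commute)
  moreover have "\<epsilon> (frame_act Q w) = Q ** \<epsilon> w" for Q w
  proof -
    have "transpose (frame_act Q w) = Q ** transpose w"
      by (simp add: vec_eq_iff frame_act_def transpose_def matrix_matrix_mult_def
          matrix_vector_mult_def)
    then show ?thesis
      by (simp add: \<epsilon>_def matrix_mul_assoc)
  qed
  ultimately show ?thesis
    unfolding SO_equivariant_stiefel_model_def SO_equivariant_embedding_def
    using image by blast
qed

section \<open>Weights of the diagonal subgroup\<close>

text \<open>An involution \<open>T\<close> splits \<open>y\<close> into the eigenvectors \<open>(y + T y) / 2\<close> and \<open>(y - T y) / 2\<close>, and these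
  remain joint eigenvectors of the involutions treated before.\<close>

lemma span_joint_eigenvectors_of_involutions:
  fixes T :: "'i \<Rightarrow> 'v::real_vector \<Rightarrow> 'v"
  assumes "finite J" "\<And>j. j \<in> J \<Longrightarrow> linear (T j)" "\<And>j x. j \<in> J \<Longrightarrow> T j (T j x) = x"
    and "\<And>i j x. i \<in> J \<Longrightarrow> j \<in> J \<Longrightarrow> T i (T j x) = T j (T i x)"
  shows "x \<in> span {y. \<forall>j\<in>J. T j y = y \<or> T j y = - y}"
  using assms
proof (induction J arbitrary: x rule: finite_induct)
  case empty
  then show ?case by (simp add: span_base)
next
  case (insert j J)
  let ?E = "\<lambda>J. {y. \<forall>j\<in>J. T j y = y \<or> T j y = - y}"
  note lin = insert.prems(1)
  have "y \<in> span (?E (insert j J))" if y: "y \<in> ?E J" for y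
  proof -
    have lj: "linear (T j)" using lin by simp
    have "T i (y + T j y) = y + T j y \<or> T i (y + T j y) = - (y + T j y)"
         "T i (y - T j y) = y - T j y \<or> T i (y - T j y) = - (y - T j y)" if "i \<in> J" for i
    proof -
      have "T i (T j y) = T j (T i y)" using insert.prems(3) that by blast
      moreover have "T i y = y \<or> T i y = - y" using y that by blast
      ultimately have "(T i y = y \<and> T i (T j y) = T j y) \<or> (T i y = - y \<and> T i (T j y) = - T j y)"
        using linear_neg [OF lj] by auto
      then show "T i (y + T j y) = y + T j y \<or> T i (y + T j y) = - (y + T j y)"
         "T i (y - T j y) = y - T j y \<or> T i (y - T j y) = - (y - T j y)"
        using lin [of i] that by (auto simp: linear_add linear_diff)
    qed
    moreover have "T j (y + T j y) = y + T j y" "T j (y - T j y) = - (y - T j y)"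
      using insert.prems(2) [of j] lj by (simp_all add: linear_add linear_diff)
    ultimately have "y + T j y \<in> ?E (insert j J)" "y - T j y \<in> ?E (insert j J)"
      by auto
    then have "(1/2) *\<^sub>R (y + T j y) + (1/2) *\<^sub>R (y - T j y) \<in> span (?E (insert j J))"
      by (intro span_add span_scale span_base)
    moreover have "(1/2) *\<^sub>R (y + T j y) + (1/2) *\<^sub>R (y - T j y) = y"
      by (simp add: algebra_simps flip: scaleR_add_left)
    ultimately show ?thesis by simp
  qed
  then have "span (?E J) \<subseteq> span (?E (insert j J))"
    by (intro span_minimal) auto
  moreover have "x \<in> span (?E J)"
    using insert.prems by (intro insert.IH) auto
  ultimately show ?case by blast
qed

text \<open>Applying one operator and subtracting a multiple of the given relation removes the last
  summand and multiplies the others by differences of eigenvalues.\<close>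

lemma joint_eigenvectors_sum_zero:
  fixes T :: "'i \<Rightarrow> 'v::real_vector \<Rightarrow> 'v"
  assumes "finite F" "\<And>i. linear (T i)" "\<And>S i. S \<in> F \<Longrightarrow> T i (x S) = c S i *\<^sub>R x S"
    and "\<And>S S'. S \<in> F \<Longrightarrow> S' \<in> F \<Longrightarrow> S \<noteq> S' \<Longrightarrow> \<exists>i. c S i \<noteq> c S' i"
    and "(\<Sum>S\<in>F. x S) = 0"
  shows "\<forall>S\<in>F. x S = 0"
  using assms(1,3-)
proof (induction F arbitrary: x rule: finite_induct)
  case empty
  then show ?case by simp
next
  case (insert R F)
  have xR: "x R = - (\<Sum>S\<in>F. x S)"
    using insert.prems(3) insert.hyps by (simp add: eq_neg_iff_add_eq_0)
  have zero: "x S = 0" if S: "S \<in> F" for S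
  proof -
    obtain i where i: "c S i \<noteq> c R i"
      using insert.prems(2) [of S R] S insert.hyps by blast
    have "T i (x R) = - (\<Sum>S\<in>F. c S i *\<^sub>R x S)"
      using insert.prems(1) by (simp add: xR linear_neg linear_sum assms(2))
    moreover have "T i (x R) = - (\<Sum>S\<in>F. c R i *\<^sub>R x S)"
      using insert.prems(1) [of R i] by (simp add: xR scaleR_sum_right)
    ultimately have "(\<Sum>S\<in>F. (c S i - c R i) *\<^sub>R x S) = 0"
      by (simp add: scaleR_diff_left sum_subtractf)
    moreover have "T l ((c S' i - c R i) *\<^sub>R x S') = c S' l *\<^sub>R ((c S' i - c R i) *\<^sub>R x S')"
      if "S' \<in> F" for S' l
      using insert.prems(1) [of S' l] that by (simp add: linear_scale assms(2))
    ultimately have "\<forall>S\<in>F. (c S i - c R i) *\<^sub>R x S = 0"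
      using insert.prems(2) by (intro insert.IH) auto
    then show ?thesis
      using i S by auto
  qed
  then show ?case
    using xR by simp
qed

lemma independent_family_card:
  fixes x :: "'i \<Rightarrow> 'v::euclidean_space"
  assumes "finite F" and zero: "\<And>u. (\<Sum>i\<in>F. u i *\<^sub>R x i) = 0 \<Longrightarrow> \<forall>i\<in>F. u i = 0"
  shows "card F \<le> DIM('v)"
proof -
  have inj: "inj_on x F"
  proof (rule inj_onI, rule ccontr)
    fix i j assume ij: "i \<in> F" "j \<in> F" "x i = x j" "i \<noteq> j"
    define u :: "'i \<Rightarrow> real" where "u = (\<lambda>l. if l = i then 1 else if l = j then -1 else 0)"
    have "(\<Sum>l\<in>F. u l *\<^sub>R x l) = (\<Sum>l\<in>{i, j}. u l *\<^sub>R x l)"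
      using ij assms(1) by (intro sum.mono_neutral_right) (auto simp: u_def)
    also have "\<dots> = 0"
      using ij by (simp add: u_def)
    finally have "u i = 0"
      using zero ij(1) by blast
    then show False by (simp add: u_def)
  qed
  have "independent (x ` F)"
    unfolding dependent_finite [OF finite_imageI [OF assms(1)]]
  proof safe
    fix u i
    assume "i \<in> F" "u (x i) \<noteq> 0" and "(\<Sum>v\<in>x ` F. u v *\<^sub>R v) = 0"
    then show False
      using zero [of "\<lambda>i. u (x i)"] by (auto simp: sum.reindex [OF inj])
  qed
  then have "card (x ` F) \<le> DIM('v)"
    by (simp add: independent_bound)
  then show ?thesis
    by (simp add: card_image [OF inj])
qed

lemma joint_eigenvectors_card:
  fixes T :: "'i \<Rightarrow> 'v::euclidean_space \<Rightarrow> 'v"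
  assumes "finite F" "\<And>i. linear (T i)" "\<And>S i. S \<in> F \<Longrightarrow> T i (x S) = c S i *\<^sub>R x S"
    and "\<And>S S'. S \<in> F \<Longrightarrow> S' \<in> F \<Longrightarrow> S \<noteq> S' \<Longrightarrow> \<exists>i. c S i \<noteq> c S' i"
    and nz: "\<And>S. S \<in> F \<Longrightarrow> x S \<noteq> 0"
  shows "card F \<le> DIM('v)"
proof (rule independent_family_card)
  fix u assume "(\<Sum>S\<in>F. u S *\<^sub>R x S) = 0"
  then have "\<forall>S\<in>F. u S *\<^sub>R x S = 0"
  proof (intro joint_eigenvectors_sum_zero [where c = c])
    show "T i (u S *\<^sub>R x S) = c S i *\<^sub>R u S *\<^sub>R x S" if "S \<in> F" for S i
      using assms(3) [OF that, of i] by (simp add: linear_scale [OF assms(2)])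
  qed (use assms in blast)+
  then show "\<forall>S\<in>F. u S = 0"
    using nz by auto
qed (rule assms(1))

lemma choose_two_le_choose_three:
  assumes "16 \<le> m"
  shows "Suc m choose 2 \<le> m choose 3"
proof -
  have three: "3 * (m choose 3) = m * ((m - 1) choose 2)"
    using times_binomial_minus1_eq [of 3 m] by simp
  have two: "2 * ((m - 1) choose 2) = (m - 1) * (m - 2)"
    using times_binomial_minus1_eq [of 2 "m - 1"] by (simp add: numeral_2_eq_2)
  have "6 * (m choose 3) = 2 * (3 * (m choose 3))"
    by simp
  also have "\<dots> = m * (2 * ((m - 1) choose 2))"
    by (simp only: three mult.left_commute)
  finally have "6 * (m choose 3) = m * ((m - 1) * (m - 2))"
    by (simp only: two)
  moreover have "2 * (Suc m choose 2) = Suc m * m"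
    using times_binomial_minus1_eq [of 2 "Suc m"] by simp
  moreover have "3 * Suc m \<le> (m - 1) * (m - 2)"
  proof -
    obtain d where "m = 16 + d" using assms le_Suc_ex by blast
    then show ?thesis by (simp add: algebra_simps)
  qed
  then have "3 * (Suc m * m) \<le> m * ((m - 1) * (m - 2))"
    by (metis mult.assoc mult.commute mult_le_mono2)
  ultimately show ?thesis by linarith
qed

lemma card_complement: "card (- S) = CARD('a) - card S"
  for S :: "'a::finite set"
  by (simp add: Compl_eq_Diff_UNIV card_Diff_subset)

locale SO_representation =
  fixes act :: "real^'n^'n \<Rightarrow> 'v::euclidean_space \<Rightarrow> 'v"
  assumes module: "SO_module act"
begin

lemma act_linear: "Q \<in> SO \<Longrightarrow> linear (act Q)"
  and act_one: "act (mat 1) x = x"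
  and act_mul: "P \<in> SO \<Longrightarrow> Q \<in> SO \<Longrightarrow> act (P ** Q) x = act P (act Q x)"
  using module by (simp_all add: SO_module_def)

lemma act_simps:
  assumes "Q \<in> SO"
  shows "act Q (x + y) = act Q x + act Q y" "act Q (x - y) = act Q x - act Q y"
    "act Q (c *\<^sub>R x) = c *\<^sub>R act Q x" "act Q (- x) = - act Q x" "act Q 0 = 0"
    "act Q (sum f I) = (\<Sum>i\<in>I. act Q (f i))"
  using act_linear [OF assms]
  by (simp_all add: linear_add linear_diff linear_scale linear_neg linear_0 linear_sum)

lemma act_inverse:
  assumes "Q \<in> SO"
  shows "act (transpose Q) (act Q x) = x" "act Q (act (transpose Q) x) = x"
  using assms
  by (simp_all add: act_mul [symmetric] SO_transpose orthogonal_matrix_cancel SO_orthogonal act_one)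

lemma act_cancel: "Q \<in> SO \<Longrightarrow> act Q x = act Q y \<longleftrightarrow> x = y"
  by (metis act_inverse(1))

abbreviation turn :: "real^'n \<Rightarrow> real^'n \<Rightarrow> 'v \<Rightarrow> 'v" where
  "turn a b \<equiv> act (half_turn a b)"

text \<open>Conjugation moves half-turns to half-turns, so statements about coordinate planes carry over to all
  pairs of orthogonal directions.\<close>

lemma act_turn:
  assumes "Q \<in> SO" "a \<noteq> 0" "b \<noteq> 0"
  shows "act Q (turn a b x) = turn (Q *v a) (Q *v b) (act Q x)"
proof -
  have orth: "orthogonal_matrix Q" using assms(1) by (rule SO_orthogonal)
  have nz: "Q *v a \<noteq> 0" "Q *v b \<noteq> 0"
    using assms orthogonal_matrix_cancel(3) [OF orth] by (metis matrix_vector_mult_0_right)+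
  have "Q ** half_turn a b = half_turn (Q *v a) (Q *v b) ** Q"
    by (metis matrix_mul_assoc reflection_conjugate [OF orth])
  then show ?thesis
    using assms nz by (simp add: act_mul [symmetric] half_turn_SO)
qed

lemma turn_comm: "a \<bullet> b = 0 \<Longrightarrow> turn a b = turn b a"
  by (metis reflection_commute)

lemma turn_turn:
  assumes "a \<bullet> b = 0" "a \<bullet> c = 0" "a \<noteq> 0" "b \<noteq> 0" "c \<noteq> 0"
  shows "turn a b (turn a c x) = turn b c x"
proof -
  have "half_turn a b ** half_turn a c = reflection b ** (reflection a ** reflection a) ** reflection c"
    using reflection_commute [OF assms(1)] by (simp add: matrix_mul_assoc)
  then show ?thesis
    using assms by (simp add: act_mul [symmetric] half_turn_SO reflection_involution)
qed

lemma turn_involution: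
  assumes "a \<bullet> b = 0" "a \<noteq> 0" "b \<noteq> 0"
  shows "turn a b (turn a b x) = x"
  using turn_turn [OF assms(1) assms(1)] assms by (simp add: reflection_involution act_one)

text \<open>A set \<open>S\<close> of coordinates stands for the character of the diagonal sign matrices of determinant
  \<open>1\<close> that multiplies the entries with index in \<open>S\<close>. These matrices are generated by half-turns in
  coordinate planes, which are the only ones used to define the weight space. Hence \<open>S\<close> and its
  complement stand for the same character.\<close>

definition weight_sign :: "'n set \<Rightarrow> 'n \<Rightarrow> real" where
  "weight_sign S i = (if i \<in> S then -1 else 1)"

definition weight_space :: "'n set \<Rightarrow> 'v set" where
  "weight_space S =
    {x. \<forall>i j. turn (axis i 1) (axis j 1) x = (weight_sign S i * weight_sign S j) *\<^sub>R x}"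

lemma weight_space_complement: "weight_space (- S) = weight_space S"
proof -
  have "weight_sign (- S) i = - weight_sign S i" for i
    by (simp add: weight_sign_def)
  then show ?thesis by (simp add: weight_space_def)
qed

lemma axis_turn_turn:
  "turn (axis i 1) (axis j 1) (turn (axis i 1) (axis l 1) x) = turn (axis j 1) (axis l 1) x"
proof (cases "i = j \<or> i = l")
  case True
  then show ?thesis
    by (cases "i = j"; cases "i = l"; cases "j = l")
      (auto simp: reflection_involution act_one turn_involution inner_axis_axis turn_comm)
next
  case False
  then show ?thesis
    by (intro turn_turn) (auto simp: inner_axis_axis)
qed

lemma weight_spaces_span: "x \<in> span (\<Union>S. weight_space S)"
proof -
  fix k :: 'n
  let ?T = "\<lambda>j. turn (axis k 1) (axis j 1)"
  let ?E = "{y. \<forall>j\<in>UNIV. ?T j y = y \<or> ?T j y = - y}"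
  have "x \<in> span ?E"
  proof (rule span_joint_eigenvectors_of_involutions)
    show "linear (?T j)" for j
      by (simp add: act_linear half_turn_SO)
    show "?T j (?T j x) = x" for j x
      by (simp add: axis_turn_turn reflection_involution act_one)
    show "?T i (?T j x) = ?T j (?T i x)" for i j x
      by (cases "i = j") (simp_all add: axis_turn_turn turn_comm inner_axis_axis)
  qed simp
  moreover have "?E \<subseteq> (\<Union>S. weight_space S)"
  proof
    fix y assume y: "y \<in> ?E"
    define S where "S = {j. ?T j y \<noteq> y}"
    have "?T j y = weight_sign S j *\<^sub>R y" for j
      using y by (auto simp: S_def weight_sign_def)
    then have "?T i (?T j y) = (weight_sign S i * weight_sign S j) *\<^sub>R y" for i j
      by (simp add: act_simps half_turn_SO mult.commute)
    then have "y \<in> weight_space S"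
      by (simp add: weight_space_def axis_turn_turn)
    then show "y \<in> (\<Union>S. weight_space S)" by blast
  qed
  ultimately show ?thesis
    using span_mono by blast
qed

text \<open>A permutation of the coordinates that carries \<open>S\<close> to \<open>S'\<close> carries the weight spaces to each other.\<close>

lemma weight_space_permute:
  assumes "x \<in> weight_space S" "x \<noteq> 0" "card S' = card S"
  obtains y where "y \<in> weight_space S'" "y \<noteq> 0"
proof -
  obtain f where f: "bij_betw f S S'"
    using finite_same_card_bij [of S S'] assms(3) by auto
  obtain g where g: "bij_betw g (- S) (- S')"
    using finite_same_card_bij [of "- S" "- S'"] assms(3) by (auto simp: card_complement)
  define p where "p i = (if i \<in> S then f i else g i)" for i
  have "bij_betw p (S \<union> - S) (S' \<union> - S')"
    by (rule bij_betw_combine)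
      (use f g bij_betw_cong [of S p f] bij_betw_cong [of "- S" p g] in \<open>auto simp: p_def\<close>)
  then have p: "inj p" "surj p" "\<And>i. p i \<in> S' \<longleftrightarrow> i \<in> S"
    using bij_betwE [OF f] bij_betwE [OF g] by (auto simp: bij_betw_def p_def)
  obtain g where g: "g \<in> reflection_products 0" "\<And>i. g *v axis i 1 = axis (p i) (1::real)"
    using reflection_products_transport [of UNIV "\<lambda>i. axis i 1" "\<lambda>i. axis (p i) 1" 0] p(1)
    by (auto simp: inner_axis_axis inj_eq)
  have orth: "orthogonal_matrix g"
    using g(1) by (rule reflection_products_orthogonal)
  \<comment> \<open>An odd permutation is corrected by a sign in one coordinate, which does not change any
    reflection along a coordinate axis.\<close>
  obtain Q where Q: "Q \<in> SO" "\<And>i. reflection (Q *v axis i 1) = reflection (axis (p i) (1::real))"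
    "\<And>i. Q *v axis i 1 \<noteq> 0"
  proof (cases "det g = 1")
    case True
    then show ?thesis
      using that [of g] g(2) orth by (simp add: SO_iff)
  next
    case False
    fix k :: 'n
    have "det g = -1"
      using False det_orthogonal_matrix [OF orth] by auto
    then have "reflection (axis k 1) ** g \<in> SO"
      by (simp add: SO_iff orthogonal_matrix_mul orth orthogonal_reflection det_mul det_reflection)
    moreover have "(reflection (axis k 1) ** g) *v axis i 1
        = (if p i = k then - axis (p i) 1 else axis (p i) (1::real))" for i
      using g(2) [of i] by (auto simp: matrix_vector_mul_assoc [symmetric] reflection_self
          reflection_orthogonal_vector inner_axis_axis)
    ultimately show ?thesis
      using that [of "reflection (axis k 1) ** g"] by (auto simp: reflection_uminus)
  qed
  have "turn (axis i' 1) (axis j' 1) (act Q x) = (weight_sign S' i' * weight_sign S' j') *\<^sub>R act Q x"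
    for i' j'
  proof -
    obtain i j where ij: "i' = p i" "j' = p j"
      using p(2) by (metis surjD)
    have "act Q (turn (axis i 1) (axis j 1) x) = turn (axis i' 1) (axis j' 1) (act Q x)"
      using Q by (simp add: act_turn ij)
    moreover have "weight_sign S i = weight_sign S' i'" "weight_sign S j = weight_sign S' j'"
      using p(3) by (simp_all add: weight_sign_def ij)
    ultimately show ?thesis
      using assms(1) Q(1) by (simp add: weight_space_def act_simps)
  qed
  moreover have "act Q x \<noteq> 0"
    using assms(2) act_cancel [OF Q(1), of x 0] Q(1) by (simp add: act_simps)
  ultimately show ?thesis
    using that [of "act Q x"] by (simp add: weight_space_def)
qed

text \<open>Distinct sets that are not complementary give distinct characters, so weight vectors for them are
  linearly independent.\<close>

lemma card_weights_le:
  assumes "\<And>S. S \<in> F \<Longrightarrow> \<exists>x\<in>weight_space S. x \<noteq> 0"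
    and "\<And>S S'. S \<in> F \<Longrightarrow> S' \<in> F \<Longrightarrow> S' \<noteq> - S"
  shows "card F \<le> DIM('v)"
proof -
  obtain x where x: "\<And>S. S \<in> F \<Longrightarrow> x S \<in> weight_space S \<and> x S \<noteq> 0"
    using assms(1) by metis
  show ?thesis
  proof (rule joint_eigenvectors_card [where T = "\<lambda>(i, j). turn (axis i 1) (axis j 1)" and x = x
        and c = "\<lambda>S (i, j). weight_sign S i * weight_sign S j"])
    fix S S' assume S: "S \<in> F" "S' \<in> F" "S \<noteq> S'"
    obtain i where "(i \<in> S) \<noteq> (i \<in> S')"
      using S(3) by blast
    moreover obtain j where "(j \<in> S) = (j \<in> S')"
      using assms(2) [OF S(1,2)] by blast
    ultimately have "weight_sign S i * weight_sign S j \<noteq> weight_sign S' i * weight_sign S' j"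
      by (auto simp: weight_sign_def)
    then show "\<exists>i. (case i of (i, j) \<Rightarrow> weight_sign S i * weight_sign S j)
        \<noteq> (case i of (i, j) \<Rightarrow> weight_sign S' i * weight_sign S' j)"
      by auto
  qed (use x in \<open>auto simp: act_linear half_turn_SO weight_space_def\<close>)
qed

text \<open>All sets with the cardinality of the given one give weights, and two of them give the same
  weight only if they are complementary. For half the dimension this is excluded by
  omitting one coordinate.\<close>

lemma large_weight_dimension:
  assumes "x \<in> weight_space S" "x \<noteq> 0" "2 \<le> card S" "2 \<le> card (- S)" "17 \<le> CARD('n)"
  shows "CARD('n) choose 2 \<le> DIM('v)"
proof -
  have half: "CARD('n) choose 2 \<le> DIM('v)"
    if S: "x \<in> weight_space S" "2 \<le> card S" "2 * card S \<le> CARD('n)" for S :: "'n set"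
  proof (cases "2 * card S < CARD('n)")
    case True
    let ?F = "{S'. S' \<subseteq> UNIV \<and> card S' = card S} :: 'n set set"
    have "CARD('n) choose 2 \<le> CARD('n) choose card S"
      using S by (intro binomial_mono) auto
    also have "\<dots> = card ?F"
      by (simp only: n_subsets [OF finite])
    also have "\<dots> \<le> DIM('v)"
    proof (rule card_weights_le)
      show "\<exists>y\<in>weight_space S'. y \<noteq> 0" if "S' \<in> ?F" for S'
        using weight_space_permute [OF S(1) assms(2), of S'] that by auto
      show "S'' \<noteq> - S'" if "S' \<in> ?F" "S'' \<in> ?F" for S' S''
        using that True card_complement [of S'] by auto
    qed
    finally show ?thesis .
  next
    case False
    then have n: "CARD('n) = 2 * card S" using S(3) by simp
    fix k :: 'n
    let ?F = "{S'. S' \<subseteq> UNIV - {k} \<and> card S' = card S} :: 'n set set"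
    have "CARD('n) choose 2 \<le> (CARD('n) - 1) choose 3"
      using choose_two_le_choose_three [of "CARD('n) - 1"] assms(5) by simp
    also have "\<dots> \<le> (CARD('n) - 1) choose (card S - 1)"
      using n assms(5) by (intro binomial_mono) auto
    also have "\<dots> = (CARD('n) - 1) choose card S"
      using n assms(5) by (subst binomial_symmetric) auto
    also have "\<dots> = card (UNIV - {k}) choose card S"
      by (simp add: card_Diff_singleton)
    also have "\<dots> = card ?F"
      by (simp only: n_subsets [OF finite])
    also have "\<dots> \<le> DIM('v)"
    proof (rule card_weights_le)
      show "\<exists>y\<in>weight_space S'. y \<noteq> 0" if "S' \<in> ?F" for S'
        using weight_space_permute [OF S(1) assms(2), of S'] that by auto
      show "S'' \<noteq> - S'" if "S' \<in> ?F" "S'' \<in> ?F" for S' S''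
        using that by auto
    qed
    finally show ?thesis .
  qed
  show ?thesis
  proof (cases "2 * card S \<le> CARD('n)")
    case True
    then show ?thesis using half assms by blast
  next
    case False
    then have "2 * card (- S) \<le> CARD('n)"
      by (simp add: card_complement)
    then show ?thesis
      using half [of "- S"] assms by (simp add: weight_space_complement)
  qed
qed

text \<open>On a weight space the operator is the scalar \<open>(1 - \<sigma>\<^sub>i \<sigma>\<^sub>j)(1 - \<sigma>\<^sub>k \<sigma>\<^sub>l)\<close> in the signs of the weight.
  This vanishes unless the set of the weight separates \<open>i\<close> from \<open>j\<close> and \<open>k\<close> from \<open>l\<close>; then both the
  set and its complement have at least two elements, and the dimension is too large.\<close>

lemma axis_turns_degenerate:
  assumes "DIM('v) < CARD('n) choose 2" "17 \<le> CARD('n)"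
    and "i \<noteq> j" "k \<noteq> l" "{i, j} \<inter> {k, l} = {}"
  shows "x - turn (axis i 1) (axis j 1) x - turn (axis k 1) (axis l 1) x
    + turn (axis i 1) (axis j 1) (turn (axis k 1) (axis l 1) x) = 0"
proof -
  define N where "N x = x - turn (axis i 1) (axis j 1) x - turn (axis k 1) (axis l 1) x
    + turn (axis i 1) (axis j 1) (turn (axis k 1) (axis l 1) x)" for x
  have lin: "linear N"
    unfolding N_def
    by (rule linearI) (simp_all add: act_simps half_turn_SO algebra_simps)
  have "N y = 0" if y: "y \<in> weight_space S" for y S
  proof (rule ccontr)
    assume "N y \<noteq> 0"
    moreover have "N y = ((1 - weight_sign S i * weight_sign S j)
        * (1 - weight_sign S k * weight_sign S l)) *\<^sub>R y"
      using y by (simp add: N_def weight_space_def act_simps half_turn_SO algebra_simps)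
    ultimately have y0: "y \<noteq> 0" and signs: "weight_sign S i * weight_sign S j \<noteq> 1"
        "weight_sign S k * weight_sign S l \<noteq> 1"
      by auto
    obtain i' j' where ij: "{i', j'} = {i, j}" "i' \<in> S" "j' \<notin> S"
      using signs(1) by (auto simp: weight_sign_def split: if_splits)
    obtain k' l' where kl: "{k', l'} = {k, l}" "k' \<in> S" "l' \<notin> S"
      using signs(2) by (auto simp: weight_sign_def split: if_splits)
    have "{i', k'} \<subseteq> S" "{j', l'} \<subseteq> - S" "i' \<noteq> k'" "j' \<noteq> l'"
      using ij kl assms(5) by auto
    then have "2 \<le> card S" "2 \<le> card (- S)"
      using card_mono [of S "{i', k'}"] card_mono [of "- S" "{j', l'}"] by auto
    then show False
      using large_weight_dimension [OF y y0] assms by simp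
  qed
  then have "N y = 0" if "y \<in> span (\<Union>S. weight_space S)" for y
    using linear_eq_0_on_span [OF lin _ that] by blast
  then show ?thesis
    using weight_spaces_span by (simp add: N_def)
qed

text \<open>An element of \<^const>\<open>SO\<close> moves four coordinate axes to the given directions.\<close>

lemma turns_degenerate:
  fixes a b c d :: "real^'n"
  assumes "DIM('v) < CARD('n) choose 2" "17 \<le> CARD('n)"
    and nz: "a \<noteq> 0" "b \<noteq> 0" "c \<noteq> 0" "d \<noteq> 0"
    and orth: "a \<bullet> b = 0" "a \<bullet> c = 0" "a \<bullet> d = 0" "b \<bullet> c = 0" "b \<bullet> d = 0" "c \<bullet> d = 0"
  shows "x - turn a b x - turn c d x + turn a b (turn c d x) = 0"
proof -
  obtain p :: "nat \<Rightarrow> 'n" where p: "inj_on p {..<4}"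
    using card_le_inj [of "{..<4::nat}" "UNIV :: 'n set"] assms(2) by auto
  define v where "v = (\<lambda>r::nat. if r = 0 then a else if r = 1 then b else if r = 2 then c else d)"
  define w where "w r = (1 / norm (v r)) *\<^sub>R v r" for r
  have "v r \<bullet> v s = 0" if "r < 4" "s < 4" "r \<noteq> s" for r s
    using that orth by (auto simp: v_def inner_commute numeral_eq_Suc less_Suc_eq)
  moreover have v0: "v r \<noteq> 0" for r
    using nz by (auto simp: v_def)
  moreover have "w r \<bullet> w r = 1" for r
    using v0 by (simp add: w_def dot_square_norm power2_eq_square)
  ultimately have "axis (p r) (1::real) \<bullet> axis (p s) 1 = w r \<bullet> w s" if "r < 4" "s < 4" for r s
    using that inj_onD [OF p, of r s]
    by (cases "r = s") (auto simp: inner_axis_axis w_def)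
  then obtain Q where Q: "Q \<in> SO" "\<And>r. r < 4 \<Longrightarrow> Q *v axis (p r) 1 = w r"
    using SO_transport [of "{..<4::nat}" "\<lambda>r. axis (p r) 1" w] assms(2) by auto
  have turn_v: "turn (v r) (v s) y = act Q (turn (axis (p r) 1) (axis (p s) 1) (act (transpose Q) y))"
    if "r < 4" "s < 4" for r s y
    using Q that v0 by (simp add: act_turn act_inverse w_def reflection_scaleR)
  have v: "a = v 0" "b = v 1" "c = v 2" "d = v 3"
    by (simp_all add: v_def)
  have "{p 0, p 1} \<inter> {p 2, p 3} = {}" "p 0 \<noteq> p 1" "p 2 \<noteq> p 3"
    using inj_on_eq_iff [OF p] by auto
  from axis_turns_degenerate [OF assms(1,2) this(2,3,1), of "act (transpose Q) x"]
  have "act Q (act (transpose Q) x - turn (axis (p 0) 1) (axis (p 1) 1) (act (transpose Q) x)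
     - turn (axis (p 2) 1) (axis (p 3) 1) (act (transpose Q) x)
     + turn (axis (p 0) 1) (axis (p 1) 1) (turn (axis (p 2) 1) (axis (p 3) 1) (act (transpose Q) x))) = 0"
    using Q(1) by (simp add: act_simps)
  then show ?thesis
    unfolding v using Q(1) by (simp add: turn_v act_simps act_inverse)
qed

end

section \<open>Representations with degenerate half-turns\<close>

text \<open>The assumption says that half-turns \<open>h\<close>, \<open>h'\<close> in orthogonal planes satisfy \<open>(1 - h)(1 - h') = 0\<close>.
  It holds in sums of trivial modules and copies of \<open>\<real>\<^sup>n\<close>, where \<open>1 - h\<close> is twice the projection onto
  the plane of \<open>h\<close> in each copy. The bound on the dimension leaves room for a direction orthogonal to
  five given vectors.\<close>

locale degenerate_SO_representation = SO_representation act
  for act :: "real^'n^'n \<Rightarrow> 'v::euclidean_space \<Rightarrow> 'v" +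
  assumes degenerate:
    "\<lbrakk>a \<noteq> 0; b \<noteq> 0; c \<noteq> 0; d \<noteq> 0; a \<bullet> b = 0; a \<bullet> c = 0; a \<bullet> d = 0; b \<bullet> c = 0; b \<bullet> d = 0; c \<bullet> d = 0\<rbrakk>
      \<Longrightarrow> x - turn a b x - turn c d x + turn a b (turn c d x) = 0"
    and dimension: "6 \<le> CARD('n)"
begin

lemma orthogonal_to_few:
  assumes "length xs \<le> 5"
  shows "\<exists>c :: real^'n. c \<noteq> 0 \<and> c \<bullet> c = 1 \<and> list_all (\<lambda>x. x \<bullet> c = 0 \<and> c \<bullet> x = 0) xs"
proof -
  have "card (set xs) < CARD('n)"
    using card_length [of xs] assms dimension by linarith
  then obtain c :: "real^'n" where c: "norm c = 1" "\<And>x. x \<in> set xs \<Longrightarrow> x \<bullet> c = 0"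
    using orthogonal_vector_exists [of "set xs"] by blast
  have "c \<bullet> x = 0" if "x \<in> set xs" for x
    using c(2) [OF that] by (simp add: inner_commute)
  then have "c \<noteq> 0 \<and> c \<bullet> c = 1 \<and> list_all (\<lambda>x. x \<bullet> c = 0 \<and> c \<bullet> x = 0) xs"
    using c by (auto simp: list_all_iff norm_eq_1)
  then show ?thesis by blast
qed

definition orthogonal_triple :: "real^'n \<Rightarrow> real^'n \<Rightarrow> real^'n \<Rightarrow> bool" where
  "orthogonal_triple a b c \<longleftrightarrow>
    a \<noteq> 0 \<and> b \<noteq> 0 \<and> c \<noteq> 0 \<and> a \<bullet> b = 0 \<and> a \<bullet> c = 0 \<and> b \<bullet> c = 0"

text \<open>This is \<open>(1 - h)(1 - h') / 4\<close> for the half-turns in the planes of \<open>a, b\<close> and of \<open>a, c\<close>. In a copy of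
  \<open>\<real>\<^sup>n\<close> these planes share only the line of \<open>a\<close>, so the operator is the projection onto that line. It
  does not depend on \<open>b\<close> and \<open>c\<close>, and \<open>proj\<close> is its common value.\<close>

definition triple_projection :: "real^'n \<Rightarrow> real^'n \<Rightarrow> real^'n \<Rightarrow> 'v \<Rightarrow> 'v" where
  "triple_projection a b c x = (1 / 4) *\<^sub>R (x - turn a b x - turn a c x + turn b c x)"

definition proj :: "real^'n \<Rightarrow> 'v \<Rightarrow> 'v" where
  "proj a x = (SOME y. \<exists>b c. orthogonal_triple a b c \<and> y = triple_projection a b c x)"

lemma triple_projection_swap:
  "orthogonal_triple a b c \<Longrightarrow> triple_projection a b c x = triple_projection a c b x"
  by (simp add: triple_projection_def orthogonal_triple_def turn_comm [of b c] algebra_simps)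

text \<open>The difference of the two projections is, up to a factor, the degeneracy relation for the planes of
  \<open>a, b\<close> and of \<open>c, d\<close>, applied to a translate of \<open>x\<close> by a half-turn.\<close>

lemma triple_projection_change_orthogonal:
  assumes abc: "orthogonal_triple a b c" and d: "d \<noteq> 0" "a \<bullet> d = 0" "b \<bullet> d = 0" "c \<bullet> d = 0"
  shows "triple_projection a b c x = triple_projection a b d x"
proof -
  have abc': "a \<noteq> 0" "b \<noteq> 0" "c \<noteq> 0" "a \<bullet> b = 0" "a \<bullet> c = 0" "b \<bullet> c = 0"
    using abc by (auto simp: orthogonal_triple_def)
  have "turn a b (turn a d x) = turn b d x" "turn a b (turn a c x) = turn b c x"
    using abc' d by (auto intro: turn_turn)
  moreover have "turn c d (turn a d x) = turn a c x"
  proof -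
    have "turn c d (turn a d x) = turn d c (turn d a x)"
      using abc' d by (simp add: turn_comm [of c d] turn_comm [of a d])
    also have "\<dots> = turn c a x"
      using abc' d by (intro turn_turn) (auto simp: inner_commute)
    finally show ?thesis
      using abc' by (simp add: turn_comm [of a c])
  qed
  ultimately have "turn a d x - turn b d x - turn a c x + turn b c x = 0"
    using degenerate [of a b c d "turn a d x"] abc' d by simp
  then have "x - turn a b x - turn a c x + turn b c x = x - turn a b x - turn a d x + turn b d x"
    by (simp add: algebra_simps)
  then show ?thesis
    by (simp only: triple_projection_def)
qed

lemma triple_projection_change_last:
  assumes "orthogonal_triple a b c" "orthogonal_triple a b d"
  shows "triple_projection a b c x = triple_projection a b d x"
proof -
  obtain e where e: "e \<noteq> 0" "a \<bullet> e = 0" "b \<bullet> e = 0" "c \<bullet> e = 0" "d \<bullet> e = 0"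
    using orthogonal_to_few [of "[a, b, c, d]"] by auto
  then show ?thesis
    using triple_projection_change_orthogonal [OF assms(1), of e]
      triple_projection_change_orthogonal [OF assms(2), of e] by simp
qed

text \<open>The vectors \<open>b\<close> and \<open>c\<close> are exchanged one at a time, through a vector \<open>e\<close> orthogonal to all of them.\<close>

lemma triple_projection_independent:
  assumes "orthogonal_triple a b c" "orthogonal_triple a b' c'"
  shows "triple_projection a b c x = triple_projection a b' c' x"
proof -
  obtain e where e: "e \<noteq> 0" "a \<bullet> e = 0" "b \<bullet> e = 0" "b' \<bullet> e = 0" "e \<bullet> b = 0" "e \<bullet> b' = 0"
    using orthogonal_to_few [of "[a, b, c, b', c']"] by auto
  have triples: "orthogonal_triple a b e" "orthogonal_triple a e b" "orthogonal_triple a e b'"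
      "orthogonal_triple a b' e"
    using assms e by (auto simp: orthogonal_triple_def)
  have "triple_projection a b c x = triple_projection a b e x"
    using assms triples by (intro triple_projection_change_last)
  also have "\<dots> = triple_projection a e b x"
    using triples by (intro triple_projection_swap)
  also have "\<dots> = triple_projection a e b' x"
    using triples by (intro triple_projection_change_last)
  also have "\<dots> = triple_projection a b' e x"
    using triples by (intro triple_projection_swap)
  also have "\<dots> = triple_projection a b' c' x"
    using assms triples by (intro triple_projection_change_last)
  finally show ?thesis .
qed

lemma proj_triple:
  assumes "orthogonal_triple a b c"
  shows "proj a x = triple_projection a b c x"
  unfolding proj_def
  by (rule some1_equality) (use assms triple_projection_independent in blast)+

lemma triple_completion:
  assumes "a \<noteq> 0" "b \<noteq> 0" "a \<bullet> b = 0"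
  shows "\<exists>c. orthogonal_triple a b c"
  using orthogonal_to_few [of "[a, b]"] assms by (auto simp: orthogonal_triple_def)

lemma triple_exists:
  assumes "a \<noteq> 0"
  shows "\<exists>b c. orthogonal_triple a b c"
proof -
  obtain b where "b \<noteq> 0" "a \<bullet> b = 0"
    using orthogonal_to_few [of "[a]"] by auto
  then show ?thesis
    using triple_completion [of a b] assms by blast
qed

lemma turn_proj:
  assumes "a \<noteq> 0" "b \<noteq> 0" "a \<bullet> b = 0"
  shows "turn a b (proj a x) = - proj a x"
proof -
  obtain c where c: "orthogonal_triple a b c"
    using triple_completion [OF assms] by blast
  then have c': "c \<noteq> 0" "a \<bullet> c = 0" "b \<bullet> c = 0"
    by (auto simp: orthogonal_triple_def)
  have "turn a b (turn b c x) = turn a c x"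
    using turn_turn [of b a c] assms c' by (simp add: turn_comm [of a b] inner_commute)
  moreover have "turn a b (turn a c x) = turn b c x"
    using assms c' by (intro turn_turn)
  ultimately show ?thesis
    using assms c' by (simp add: proj_triple [OF c] triple_projection_def act_simps half_turn_SO
        turn_involution algebra_simps)
qed

text \<open>The half-turn is the product of two half-turns that reverse \<open>a\<close>, and each of them acts as \<open>-1\<close>.\<close>

lemma turn_proj_orthogonal:
  assumes "a \<noteq> 0" "b \<noteq> 0" "c \<noteq> 0" "a \<bullet> b = 0" "a \<bullet> c = 0"
  shows "turn b c (proj a x) = proj a x"
  using turn_turn [of a b c "proj a x"] turn_proj [of a c x] turn_proj [of a b x] assms
  by (simp add: act_simps half_turn_SO)

lemma proj_simps:
  assumes "a \<noteq> 0"
  shows "proj a (x + y) = proj a x + proj a y" "proj a (x - y) = proj a x - proj a y"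
    "proj a (r *\<^sub>R x) = r *\<^sub>R proj a x" "proj a 0 = 0" "proj a (- x) = - proj a x"
    "proj a (sum f I) = (\<Sum>i\<in>I. proj a (f i))"
proof -
  obtain b c where "orthogonal_triple a b c"
    using triple_exists assms by blast
  then have "linear (proj a)"
    by (intro linearI)
      (auto simp: proj_triple triple_projection_def orthogonal_triple_def act_simps half_turn_SO
        algebra_simps)
  then show "proj a (x + y) = proj a x + proj a y" "proj a (x - y) = proj a x - proj a y"
    "proj a (r *\<^sub>R x) = r *\<^sub>R proj a x" "proj a 0 = 0" "proj a (- x) = - proj a x"
    "proj a (sum f I) = (\<Sum>i\<in>I. proj a (f i))"
    by (simp_all add: linear_add linear_diff linear_scale linear_0 linear_neg linear_sum)
qed

lemma proj_idem:
  assumes "a \<noteq> 0"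
  shows "proj a (proj a x) = proj a x"
proof -
  obtain b c where bc: "orthogonal_triple a b c"
    using triple_exists assms by blast
  then have "turn a b (proj a x) = - proj a x" "turn a c (proj a x) = - proj a x"
    "turn b c (proj a x) = proj a x"
    by (auto simp: orthogonal_triple_def turn_proj turn_proj_orthogonal)
  then show ?thesis
    by (simp add: proj_triple [OF bc, of "proj a x"] triple_projection_def)
      (simp add: algebra_simps flip: scaleR_add_left)
qed

text \<open>For \<open>c\<close> and \<open>d\<close> orthogonal to both vectors, the half-turns that define \<open>proj a\<close> fix the range of
  \<open>proj b\<close>, so the four terms cancel.\<close>

lemma proj_orthogonal:
  assumes "a \<noteq> 0" "b \<noteq> 0" "a \<bullet> b = 0"
  shows "proj a (proj b x) = 0"
proof -
  obtain c where c: "c \<noteq> 0" "a \<bullet> c = 0" "b \<bullet> c = 0"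
    using orthogonal_to_few [of "[a, b]"] by auto
  obtain d where "d \<noteq> 0" "a \<bullet> d = 0" "b \<bullet> d = 0" "c \<bullet> d = 0"
    using orthogonal_to_few [of "[a, b, c]"] by auto
  with c assms have d: "orthogonal_triple a c d" "b \<bullet> d = 0"
    by (auto simp: orthogonal_triple_def)
  have "turn a c (proj b x) = proj b x" "turn a d (proj b x) = proj b x" "turn c d (proj b x) = proj b x"
    using assms c d by (auto simp: orthogonal_triple_def inner_commute intro!: turn_proj_orthogonal)
  then show ?thesis
    by (simp add: proj_triple [OF d(1)] triple_projection_def)
qed

lemma diff_turn_eq_proj:
  assumes "a \<noteq> 0" "b \<noteq> 0" "a \<bullet> b = 0"
  shows "x - turn a b x = 2 *\<^sub>R (proj a x + proj b x)"
proof -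
  obtain c where c: "orthogonal_triple a b c"
    using triple_completion [OF assms] by blast
  then have "orthogonal_triple b a c"
    by (auto simp: orthogonal_triple_def inner_commute)
  moreover have "turn b a = turn a b"
    using turn_comm [OF assms(3)] by (rule sym)
  ultimately show ?thesis
    by (simp add: proj_triple [OF c] proj_triple [of b a c] triple_projection_def)
      (simp add: algebra_simps flip: scaleR_add_left)
qed

lemma act_proj:
  assumes "Q \<in> SO" "a \<noteq> 0"
  shows "act Q (proj a x) = proj (Q *v a) (act Q x)"
proof -
  obtain b c where bc: "orthogonal_triple a b c"
    using triple_exists assms by blast
  have orth: "orthogonal_matrix Q"
    using assms(1) by (rule SO_orthogonal)
  have nz: "Q *v z \<noteq> 0" if "z \<noteq> 0" for z
    using that orthogonal_matrix_cancel(3) [OF orth] by (metis matrix_vector_mult_0_right)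
  then have Qbc: "orthogonal_triple (Q *v a) (Q *v b) (Q *v c)"
    using bc by (simp add: orthogonal_triple_def orthogonal_matrix_inner [OF orth])
  then show ?thesis
    using bc assms
    by (auto simp: proj_triple [OF bc] proj_triple [OF Qbc] triple_projection_def orthogonal_triple_def
        act_simps act_turn half_turn_SO)
qed

lemma proj_uminus:
  assumes "a \<noteq> 0"
  shows "proj (- a) x = proj a x"
proof -
  obtain b c where bc: "orthogonal_triple a b c"
    using triple_exists assms by blast
  then have "orthogonal_triple (- a) b c"
    by (simp add: orthogonal_triple_def)
  then show ?thesis
    using bc by (simp add: proj_triple triple_projection_def reflection_uminus)
qed

text \<open>The half-turn in a plane is the same for every orthonormal basis of the plane. Hence so is the sum of
  the projections for the two basis vectors, and a projection in the plane factors through it.\<close>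

lemma proj_plane:
  fixes a b :: "real^'n"
  assumes ab: "a \<bullet> a = 1" "b \<bullet> b = 1" "a \<bullet> b = 0" and unit: "\<alpha>\<^sup>2 + \<beta>\<^sup>2 = 1"
    and c: "c = \<alpha> *\<^sub>R a + \<beta> *\<^sub>R b"
  shows "proj c x = proj c (proj a x) + proj c (proj b x)"
proof -
  define d where "d = \<beta> *\<^sub>R a - \<alpha> *\<^sub>R b"
  have cd: "c \<bullet> c = 1" "d \<bullet> d = 1" "c \<bullet> d = 0"
    using ab unit inner_commute [of b a]
    by (simp_all add: c d_def inner_simps power2_eq_square algebra_simps)
  have "half_turn c d = half_turn a b"
  proof -
    have plane: "half_turn u v *v z = z - 2 *\<^sub>R ((u \<bullet> z) *\<^sub>R u + (v \<bullet> z) *\<^sub>R v)"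
      if "u \<bullet> u = 1" "v \<bullet> v = 1" "u \<bullet> v = 0" for u v z :: "real^'n"
      using that by (simp add: matrix_vector_mul_assoc [symmetric] reflection_apply inner_diff_right
          algebra_simps)
    have "(c \<bullet> z) *\<^sub>R c + (d \<bullet> z) *\<^sub>R d
        = (\<alpha>\<^sup>2 + \<beta>\<^sup>2) *\<^sub>R ((a \<bullet> z) *\<^sub>R a + (b \<bullet> z) *\<^sub>R b)" for z
      by (simp add: c d_def inner_simps power2_eq_square algebra_simps)
    then show ?thesis
      by (simp add: matrix_eq plane ab cd unit)
  qed
  then have "2 *\<^sub>R (proj c x + proj d x) = 2 *\<^sub>R (proj a x + proj b x)"
    using diff_turn_eq_proj [of c d x] diff_turn_eq_proj [of a b x] ab cd
    by (metis unit_nonzero)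
  then have "proj c (proj c x + proj d x) = proj c (proj a x + proj b x)"
    by simp
  then show ?thesis
    using cd by (simp add: proj_simps proj_idem proj_orthogonal unit_nonzero)
qed

definition line_space :: "real^'n \<Rightarrow> 'v set" where
  "line_space a = {x. proj a x = x}"

text \<open>Half-turns in planes orthogonal to \<open>u\<close> are trivial on the range of \<open>proj u\<close>, and a product of an even
  number of reflections decomposes into half-turns. The mirrors need not be orthogonal to each other,
  so an auxiliary direction \<open>c\<close> is inserted; the second conjunct keeps track of the odd products.\<close>

lemma line_space_reflection_products:
  assumes "g \<in> reflection_products u" "u \<noteq> 0" "x \<in> line_space u"
  shows "(det g = 1 \<longrightarrow> act g x = x)
    \<and> (det g = -1 \<longrightarrow> (\<forall>c. c \<noteq> 0 \<longrightarrow> c \<bullet> u = 0 \<longrightarrow> act (reflection c ** g) x = x))"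
  using assms(1)
proof (induction rule: reflection_products.induct)
  case one
  then show ?case by (simp add: act_one)
next
  case (step g m)
  have orth: "orthogonal_matrix g"
    using step.hyps(1) by (rule reflection_products_orthogonal)
  have turn_x: "turn a b x = x" if "a \<noteq> 0" "b \<noteq> 0" "a \<bullet> u = 0" "b \<bullet> u = 0" for a b
    using turn_proj_orthogonal [of u a b x] assms(2,3) that
    by (simp add: line_space_def inner_commute)
  have det: "det (reflection m ** g) = - det g"
    using step.hyps(2) by (simp add: det_mul det_reflection)
  show ?case
  proof (intro conjI impI allI)
    assume "det (reflection m ** g) = 1"
    then have "det g = -1" using det by simp
    obtain c where c: "c \<noteq> 0" "c \<bullet> u = 0" "c \<bullet> m = 0"
      using orthogonal_to_few [of "[u, m]"] by auto
    have fix_x: "act (reflection c ** g) x = x"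
      using step.IH \<open>det g = -1\<close> c by blast
    have "reflection c ** g \<in> SO"
      using \<open>det g = -1\<close> c orth
      by (simp add: SO_iff det_mul det_reflection orthogonal_matrix_mul orthogonal_reflection)
    moreover have "reflection m ** g = half_turn m c ** (reflection c ** g)"
      by (metis matrix_mul_assoc matrix_mul_lid reflection_involution)
    ultimately show "act (reflection m ** g) x = x"
      using fix_x turn_x [of m c] c step.hyps by (simp add: act_mul half_turn_SO)
  next
    fix c :: "real^'n"
    assume "det (reflection m ** g) = -1" and c: "c \<noteq> 0" "c \<bullet> u = 0"
    then have "det g = 1" using det by simp
    then have g: "g \<in> SO" "act g x = x"
      using orth step.IH by (simp_all add: SO_iff)
    have "reflection c ** (reflection m ** g) = half_turn c m ** g"
      by (simp add: matrix_mul_assoc)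
    then show "act (reflection c ** (reflection m ** g)) x = x"
      using g c turn_x [of c m] step.hyps by (simp add: act_mul half_turn_SO)
  qed
qed

text \<open>The induction for transporting the coordinate axes, carried out with mirrors through \<open>u\<close>, writes
  \<open>Q\<close> as a product of such reflections.\<close>

lemma line_space_stabilizer:
  assumes "x \<in> line_space u" "u \<noteq> 0" "Q \<in> SO" "Q *v u = u"
  shows "act Q x = x"
proof -
  note inner_Q = orthogonal_matrix_inner [OF SO_orthogonal [OF assms(3)]]
  obtain g where g: "g \<in> reflection_products u" "\<And>i. g *v axis i 1 = Q *v axis i (1::real)"
    using reflection_products_transport [of UNIV "\<lambda>i. axis i 1" "\<lambda>i. Q *v axis i 1" u]
      inner_Q assms(4) by auto (metis inner_Q)
  then have "g = Q"
    by (simp add: matrix_vector_mult_basis matrix_eq_columns)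
  then show ?thesis
    using line_space_reflection_products [OF g(1) assms(2,1)] assms(3) by (simp add: SO_iff)
qed

end

section \<open>The spherical function\<close>

lemma SO_moves_unit_vector:
  fixes a b :: "real^'n"
  assumes "a \<bullet> a = b \<bullet> b" "1 < CARD('n)"
  obtains Q where "Q \<in> SO" "Q *v a = b"
  using SO_transport [of "{()}" "\<lambda>_. a" "\<lambda>_. b"] assms by auto

lemma SO_moves_pair:
  fixes a b a' b' :: "real^'n"
  assumes "a \<bullet> a = a' \<bullet> a'" "b \<bullet> b = b' \<bullet> b'" "a \<bullet> b = a' \<bullet> b'" "2 < CARD('n)"
  obtains Q where "Q \<in> SO" "Q *v a = a'" "Q *v b = b'"
proof -
  have "(if i then a else b) \<bullet> (if j then a else b) = (if i then a' else b') \<bullet> (if j then a' else b')"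
    for i j
    using assms by (cases i; cases j) (simp_all add: inner_commute)
  then obtain Q where "Q \<in> SO" "\<And>i. Q *v (if i then a else b) = (if i then a' else b')"
    using SO_transport [of UNIV "\<lambda>i. if i then a else b" "\<lambda>i. if i then a' else b'"] assms(4)
    by auto
  then show ?thesis
    using that [of Q] by (metis (full_types))
qed

lemma continuous_on_reflection:
  fixes m :: "'a::topological_space \<Rightarrow> real^'n"
  assumes "continuous_on T m" "\<And>t. t \<in> T \<Longrightarrow> m t \<noteq> 0"
  shows "continuous_on T (\<lambda>t. reflection (m t))"
proof -
  have "reflection v = (\<chi> i j. (if i = j then 1 else 0) - 2 * (v $ j) * (v $ i) / (v \<bullet> v))"
    for v :: "real^'n"
    by (simp add: reflection_def matrix_def vec_eq_iff inner_axis) (simp add: axis_def)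
  then show ?thesis
    using assms by (simp only:) (intro continuous_intros; simp)
qed

locale pointed_degenerate_SO_representation = degenerate_SO_representation act
  for act :: "real^'n^'n \<Rightarrow> 'v::euclidean_space \<Rightarrow> 'v" +
  fixes p q :: "real^'n"
  assumes pq: "p \<bullet> p = 1" "q \<bullet> q = 1" "p \<bullet> q = 0" "q \<bullet> p = 0"
begin

lemma pq_nonzero: "p \<noteq> 0" "q \<noteq> 0"
  using pq by auto

text \<open>By \<open>line_space_stabilizer\<close> the value on the range of \<open>proj p\<close> does not depend on the choice of \<open>Q\<close>.\<close>

definition transport :: "real^'n \<Rightarrow> 'v \<Rightarrow> 'v" where
  "transport a y = act (SOME Q. Q \<in> SO \<and> Q *v p = a) y"

lemma transport_eq:
  assumes "y \<in> line_space p" "Q \<in> SO" "Q *v p = a"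
  shows "transport a y = act Q y"
proof -
  define P where "P = (SOME Q. Q \<in> SO \<and> Q *v p = a)"
  have P: "P \<in> SO" "P *v p = a"
    unfolding P_def using someI [of "\<lambda>Q. Q \<in> SO \<and> Q *v p = a" Q] assms by auto
  have "(transpose Q ** P) *v p = p"
    using P assms orthogonal_matrix_cancel(3) [OF SO_orthogonal]
    by (metis matrix_vector_mul_assoc)
  then have "act (transpose Q ** P) y = y"
    using assms P by (intro line_space_stabilizer [of y p]) (auto simp: pq_nonzero SO_mul SO_transpose)
  then have "act Q (act (transpose Q) (act P y)) = act Q y"
    using assms P by (simp add: act_mul SO_transpose)
  then show ?thesis
    using assms(2) by (simp add: act_inverse transport_def P_def)
qed

lemma mover_exists:
  assumes "a \<bullet> a = 1"
  obtains Q where "Q \<in> SO" "Q *v p = a"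
  using SO_moves_unit_vector [of p a] assms pq dimension by auto

lemma line_space_simps:
  assumes "a \<noteq> 0"
  shows "0 \<in> line_space a" "x \<in> line_space a \<Longrightarrow> y \<in> line_space a \<Longrightarrow> x + y \<in> line_space a"
    "x \<in> line_space a \<Longrightarrow> r *\<^sub>R x \<in> line_space a" "proj a z \<in> line_space a"
    "(\<And>i. i \<in> I \<Longrightarrow> f i \<in> line_space a) \<Longrightarrow> sum f I \<in> line_space a"
  using assms by (simp_all add: line_space_def proj_simps proj_idem)

lemma transport_in:
  assumes "y \<in> line_space p" "a \<bullet> a = 1"
  shows "transport a y \<in> line_space a"
proof -
  obtain Q where Q: "Q \<in> SO" "Q *v p = a"
    using mover_exists assms(2) by blast
  then have "proj a (act Q y) = act Q y"
    using assms(1) act_proj [of Q p y] by (simp add: pq_nonzero line_space_def)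
  then show ?thesis
    using transport_eq [OF assms(1) Q] by (simp add: line_space_def)
qed

lemma transport_simps:
  assumes "x \<in> line_space p" "y \<in> line_space p" "a \<bullet> a = 1"
  shows "transport a (x + y) = transport a x + transport a y"
    "transport a (r *\<^sub>R y) = r *\<^sub>R transport a y"
    "transport a x = transport a y \<longleftrightarrow> x = y"
    "transport a 0 = 0"
proof -
  obtain Q where Q: "Q \<in> SO" "Q *v p = a"
    using mover_exists assms(3) by blast
  show "transport a (x + y) = transport a x + transport a y"
    "transport a (r *\<^sub>R y) = r *\<^sub>R transport a y"
    "transport a x = transport a y \<longleftrightarrow> x = y"
    "transport a 0 = 0"
    using assms Q by (simp_all add: transport_eq [OF _ Q] line_space_simps pq_nonzero act_simps act_cancel)
qed

lemma transport_p: "y \<in> line_space p \<Longrightarrow> transport p y = y"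
  using transport_eq [of y "mat 1" p] by (simp add: SO_one act_one)

lemma transport_minus_p: "y \<in> line_space p \<Longrightarrow> transport (- p) y = - y"
  using transport_eq [of y "half_turn p q" "- p"] turn_proj [of p q y] pq pq_nonzero
  by (simp add: half_turn_SO line_space_def matrix_vector_mul_assoc [symmetric]
      reflection_orthogonal_vector reflection_self)

text \<open>A rotation in the plane of \<open>p\<close> and \<open>q\<close> that moves \<open>p\<close> to a unit vector with first coordinate \<open>t\<close>.
  The axis of the first reflection is \<open>p - rot t p\<close> divided by \<open>sqrt (1 - t)\<close>, so it does not vanish
  at \<open>t = 1\<close>; this makes \<open>rot\<close> continuous on the closed interval.\<close>

definition rot :: "real \<Rightarrow> real^'n^'n" where
  "rot t = reflection (sqrt (1 - t) *\<^sub>R p - sqrt (1 + t) *\<^sub>R q) ** reflection q"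

lemma mirror_square:
  assumes "\<bar>t\<bar> \<le> 1"
  shows "(sqrt (1 - t) *\<^sub>R p - sqrt (1 + t) *\<^sub>R q) \<bullet> (sqrt (1 - t) *\<^sub>R p - sqrt (1 + t) *\<^sub>R q) = 2"
  using assms pq by (simp add: inner_simps abs_le_iff)

lemma mirror_nonzero: "\<bar>t\<bar> \<le> 1 \<Longrightarrow> sqrt (1 - t) *\<^sub>R p - sqrt (1 + t) *\<^sub>R q \<noteq> 0"
  using mirror_square by fastforce

lemma rot_SO: "\<bar>t\<bar> \<le> 1 \<Longrightarrow> rot t \<in> SO"
  unfolding rot_def by (intro half_turn_SO mirror_nonzero pq_nonzero)

lemma rot_p:
  assumes "\<bar>t\<bar> \<le> 1"
  shows "rot t *v p = t *\<^sub>R p + (sqrt (1 - t) * sqrt (1 + t)) *\<^sub>R q"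
proof -
  let ?m = "sqrt (1 - t) *\<^sub>R p - sqrt (1 + t) *\<^sub>R q"
  have "?m \<bullet> p = sqrt (1 - t)"
    using pq by (simp add: inner_simps)
  then have "rot t *v p = p - sqrt (1 - t) *\<^sub>R ?m"
    using pq mirror_square [OF assms]
    by (simp add: rot_def matrix_vector_mul_assoc [symmetric] reflection_orthogonal_vector
        reflection_apply [of ?m])
  also have "\<dots> = t *\<^sub>R p + (sqrt (1 - t) * sqrt (1 + t)) *\<^sub>R q"
    using assms by (simp add: algebra_simps abs_le_iff)
  finally show ?thesis .
qed

lemma continuous_on_rot: "continuous_on {-1..1} rot"
proof -
  have "continuous_on {-1..1} (\<lambda>t. reflection (sqrt (1 - t) *\<^sub>R p - sqrt (1 + t) *\<^sub>R q))"
    by (intro continuous_on_reflection continuous_intros mirror_nonzero) auto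
  then show ?thesis
    unfolding rot_def matrix_matrix_mult_def
    by (intro continuous_intros)
qed

text \<open>The compression of a group element to the range of \<open>proj p\<close>, an operator-valued spherical function.
  For a sum of copies of \<open>\<real>\<^sup>n\<close> it is multiplication by \<open>t\<close>.\<close>

definition spherical :: "real \<Rightarrow> 'v \<Rightarrow> 'v" where
  "spherical t y = proj p (act (rot t) y)"

lemma spherical_in: "spherical t y \<in> line_space p"
  by (simp add: spherical_def line_space_simps pq_nonzero)

lemma spherical_simps:
  assumes "\<bar>t\<bar> \<le> 1"
  shows "spherical t (x + y) = spherical t x + spherical t y"
    "spherical t (r *\<^sub>R y) = r *\<^sub>R spherical t y"
  using assms by (simp_all add: spherical_def act_simps rot_SO proj_simps pq_nonzero)

text \<open>The pair \<open>a, b\<close> is congruent to the pair \<open>rot t p, p\<close> with \<open>t = a \<bullet> b\<close>, and all maps involved are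
  equivariant. So the inner product is the only invariant that enters.\<close>

lemma proj_transport:
  assumes "a \<bullet> a = 1" "b \<bullet> b = 1" "y \<in> line_space p"
  shows "proj b (transport a y) = transport b (spherical (a \<bullet> b) y)"
proof -
  let ?t = "a \<bullet> b"
  have t: "\<bar>?t\<bar> \<le> 1"
    using assms by (intro inner_unit_bound)
  have unit: "(rot ?t *v p) \<bullet> (rot ?t *v p) = 1"
    using pq by (simp add: orthogonal_matrix_inner SO_orthogonal rot_SO t)
  have "(rot ?t *v p) \<bullet> p = ?t"
    using pq by (simp add: rot_p [OF t] inner_simps)
  then obtain Q where Q: "Q \<in> SO" "Q *v (rot ?t *v p) = a" "Q *v p = b"
    using SO_moves_pair [of "rot ?t *v p" a p b] assms unit pq dimension by auto
  have "transport a y = act Q (act (rot ?t) y)"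
    using transport_eq [OF assms(3), of "Q ** rot ?t" a] Q rot_SO [OF t]
    by (simp add: SO_mul act_mul matrix_vector_mul_assoc [symmetric])
  then have "proj b (transport a y) = act Q (spherical ?t y)"
    using Q by (simp add: spherical_def act_proj pq_nonzero)
  then show ?thesis
    using transport_eq [OF spherical_in Q(1,3)] by simp
qed

lemma spherical_one: "y \<in> line_space p \<Longrightarrow> spherical 1 y = y"
  using proj_transport [of p p y] pq
  by (simp add: transport_p spherical_in) (simp add: line_space_def)

lemma spherical_zero:
  assumes "y \<in> line_space p"
  shows "spherical 0 y = 0"
proof -
  have "proj p (transport q y) = proj p (proj q (transport q y))"
    using transport_in [OF assms, of q] pq by (simp add: line_space_def)
  also have "\<dots> = 0"
    using pq pq_nonzero by (intro proj_orthogonal)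
  finally show ?thesis
    using proj_transport [of q p y] assms pq by (simp add: transport_p spherical_in)
qed

text \<open>The directions \<open>p\<close> and \<open>-p\<close> have the same projection, but transport to \<open>-p\<close> changes the sign.\<close>

lemma spherical_minus:
  assumes "y \<in> line_space p" "\<bar>t\<bar> \<le> 1"
  shows "spherical (- t) y = - spherical t y"
proof -
  let ?a = "rot t *v p"
  have a: "?a \<bullet> ?a = 1" "?a \<bullet> p = t"
    using pq assms(2) by (simp_all add: orthogonal_matrix_inner SO_orthogonal rot_SO)
      (simp add: rot_p inner_simps)
  have "proj p (transport ?a y) = spherical t y"
    using proj_transport [of ?a p y] a pq assms(1) by (simp add: transport_p spherical_in)
  moreover have "proj (- p) (transport ?a y) = - spherical (- t) y"
    using proj_transport [of ?a "- p" y] a pq assms(1) by (simp add: transport_minus_p spherical_in)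
  ultimately show ?thesis
    using pq_nonzero by (simp add: proj_uminus)
qed

lemma proj_plane_transport:
  fixes b c :: "real^'n"
  assumes "b \<bullet> b = 1" "c \<bullet> c = 1" "b \<bullet> c = 0" "\<alpha>\<^sup>2 + \<beta>\<^sup>2 = 1"
    and "y \<in> line_space p" "z \<in> line_space p"
    and "proj b x = transport b y" "proj c x = transport c z"
  shows "proj (\<alpha> *\<^sub>R b + \<beta> *\<^sub>R c) x
    = transport (\<alpha> *\<^sub>R b + \<beta> *\<^sub>R c) (spherical \<alpha> y + spherical \<beta> z)"
proof -
  let ?a = "\<alpha> *\<^sub>R b + \<beta> *\<^sub>R c"
  have cb: "c \<bullet> b = 0"
    using assms(3) by (simp add: inner_commute)
  have a: "?a \<bullet> ?a = 1" "b \<bullet> ?a = \<alpha>" "c \<bullet> ?a = \<beta>"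
    using assms(1-4) cb by (simp_all add: inner_simps power2_eq_square)
  have "proj ?a x = proj ?a (proj b x) + proj ?a (proj c x)"
    using assms by (intro proj_plane) auto
  also have "\<dots> = transport ?a (spherical \<alpha> y) + transport ?a (spherical \<beta> z)"
    using assms a by (simp add: proj_transport)
  also have "\<dots> = transport ?a (spherical \<alpha> y + spherical \<beta> z)"
    using a by (simp add: transport_simps spherical_in)
  finally show ?thesis .
qed

abbreviation diagonal :: real where "diagonal \<equiv> 1 / sqrt 2"

text \<open>The vector \<open>u\<close> has coordinates \<open>s\<close> and \<open>t\<close> in directions \<open>p\<close> and \<open>q\<close>, so its inner product with the
  diagonal direction of the plane is \<open>(s + t) / sqrt 2\<close>. The projection to the diagonal direction is
  computed directly and through the projections to \<open>p\<close> and \<open>q\<close>.\<close>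

lemma spherical_diagonal:
  assumes "y \<in> line_space p" "s\<^sup>2 + t\<^sup>2 \<le> 1"
  shows "spherical ((s + t) * diagonal) y = spherical diagonal (spherical s y + spherical t y)"
proof -
  obtain r where r: "r \<bullet> r = 1" "p \<bullet> r = 0" "q \<bullet> r = 0" "r \<bullet> p = 0" "r \<bullet> q = 0"
    using orthogonal_to_few [of "[p, q]"] by auto
  let ?u = "s *\<^sub>R p + t *\<^sub>R q + sqrt (1 - s\<^sup>2 - t\<^sup>2) *\<^sub>R r"
  let ?a = "diagonal *\<^sub>R p + diagonal *\<^sub>R q"
  have dd: "diagonal\<^sup>2 + diagonal\<^sup>2 = 1"
    by (simp add: power_divide)
  have u: "?u \<bullet> ?u = 1" "?u \<bullet> p = s" "?u \<bullet> q = t"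
    using pq r assms(2) by (simp_all add: inner_simps) (simp add: power2_eq_square algebra_simps)
  have a: "?a \<bullet> ?a = 1"
    using pq dd by (simp add: inner_simps power2_eq_square)
  have ua: "?u \<bullet> ?a = (s + t) * diagonal"
    using u by (simp add: inner_add_right inner_scaleR_right algebra_simps add_divide_distrib)
  have "transport ?a (spherical ((s + t) * diagonal) y) = proj ?a (transport ?u y)"
    using proj_transport [OF u(1) a assms(1)] ua by simp
  also have "\<dots> = transport ?a (spherical diagonal (spherical s y) + spherical diagonal (spherical t y))"
  proof (rule proj_plane_transport)
    show "proj p (transport ?u y) = transport p (spherical s y)"
      using proj_transport [OF u(1) pq(1) assms(1)] u(2) by simp
    show "proj q (transport ?u y) = transport q (spherical t y)"
      using proj_transport [OF u(1) pq(2) assms(1)] u(3) by simp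
  qed (use pq dd in \<open>auto simp: spherical_in\<close>)
  also have "\<dots> = transport ?a (spherical diagonal (spherical s y + spherical t y))"
    by (simp add: spherical_simps)
  finally show ?thesis
    using transport_simps(3) [OF spherical_in spherical_in a] by simp
qed

text \<open>With both coordinates equal to \<open>1 / sqrt 2\<close> the previous relation says that twice the square of the
  operator is the identity.\<close>

lemma spherical_diagonal_cancel:
  assumes "y \<in> line_space p" "z \<in> line_space p" "spherical diagonal y = spherical diagonal z"
  shows "y = z"
proof -
  have inverse: "spherical diagonal (2 *\<^sub>R spherical diagonal x) = x" if "x \<in> line_space p" for x
    using spherical_diagonal [OF that, of diagonal diagonal] spherical_one [OF that]
    by (simp add: power_divide scaleR_2)
  show ?thesis
    by (metis inverse assms)
qed

text \<open>After applying the operator at \<open>1 / sqrt 2\<close>, which is injective, both sides become the value at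
  \<open>(s + t) / sqrt 2\<close>: the left side by the diagonal relation for \<open>s + t\<close> and \<open>0\<close>, the right side by
  the one for \<open>s\<close> and \<open>t\<close>.\<close>

lemma spherical_add:
  assumes y: "y \<in> line_space p" and "s\<^sup>2 + t\<^sup>2 \<le> 1" "\<bar>s + t\<bar> \<le> 1"
  shows "spherical (s + t) y = spherical s y + spherical t y"
proof (rule spherical_diagonal_cancel)
  have "spherical diagonal (spherical (s + t) y) = spherical ((s + t) * diagonal) y"
    using spherical_diagonal [OF y, of "s + t" 0] assms(3)
    by (simp add: spherical_zero y abs_square_le_1)
  also have "\<dots> = spherical diagonal (spherical s y + spherical t y)"
    by (rule spherical_diagonal [OF y assms(2)])
  finally show "spherical diagonal (spherical (s + t) y) = spherical diagonal (spherical s y + spherical t y)" .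
qed (auto simp: spherical_in line_space_simps pq_nonzero)

text \<open>Additivity applies to \<open>j / N\<close> and \<open>1 / N\<close> as long as \<open>j + 1 \<le> N\<close>, because \<open>j\<^sup>2 + 1 \<le> (j + 1)\<^sup>2\<close>. The
  value at \<open>N / N = 1\<close> then determines the one at \<open>1 / N\<close>.\<close>

lemma spherical_rational:
  assumes y: "y \<in> line_space p" and "0 < N" "j \<le> N"
  shows "spherical (real j / real N) y = (real j / real N) *\<^sub>R y"
proof -
  have multiple: "spherical (real j / real N) y = real j *\<^sub>R spherical (1 / real N) y" if "j \<le> N" for j
    using that
  proof (induction j)
    case 0
    then show ?case by (simp add: spherical_zero y)
  next
    case (Suc j)
    have "real j ^ 2 + 1 \<le> real N ^ 2"
    proof -
      have "real j ^ 2 + 1 \<le> (real j + 1) ^ 2"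
        by (simp add: power2_eq_square algebra_simps)
      also have "\<dots> \<le> real N ^ 2"
        using Suc.prems by (intro power_mono) auto
      finally show ?thesis .
    qed
    then have "(real j / real N)\<^sup>2 + (1 / real N)\<^sup>2 \<le> 1"
      using assms(2) by (simp add: power_divide flip: add_divide_distrib)
    moreover have "\<bar>real j / real N + 1 / real N\<bar> \<le> 1"
      using Suc.prems assms(2) by (simp flip: add_divide_distrib)
    ultimately have "spherical (real j / real N + 1 / real N) y
        = spherical (real j / real N) y + spherical (1 / real N) y"
      by (rule spherical_add [OF y])
    then show ?case
      using Suc by (simp add: add_divide_distrib algebra_simps)
  qed
  have "y = real N *\<^sub>R spherical (1 / real N) y"
    using multiple [of N] assms(2) spherical_one [OF y] by simp
  then have "spherical (1 / real N) y = (1 / real N) *\<^sub>R y"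
    using assms(2) by (metis divide_self_if mult.commute of_nat_0_less_iff less_irrefl scaleR_one
        scaleR_scaleR times_divide_eq_left mult_1)
  then show ?thesis
    using multiple [OF assms(3)] by simp
qed

definition continuous_vectors :: "'v set" where
  "continuous_vectors = {x. continuous_on SO (\<lambda>Q. act Q x)}"

lemma continuous_vectors_simps:
  shows "x \<in> continuous_vectors \<Longrightarrow> y \<in> continuous_vectors \<Longrightarrow> x + y \<in> continuous_vectors"
    "x \<in> continuous_vectors \<Longrightarrow> y \<in> continuous_vectors \<Longrightarrow> x - y \<in> continuous_vectors"
    "x \<in> continuous_vectors \<Longrightarrow> r *\<^sub>R x \<in> continuous_vectors"
proof -
  have "continuous_on SO (\<lambda>Q. act Q (x + y))"
    if "continuous_on SO (\<lambda>Q. act Q x)" "continuous_on SO (\<lambda>Q. act Q y)"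
    by (rule continuous_on_eq [OF continuous_on_add [OF that]]) (simp add: act_simps)
  moreover have "continuous_on SO (\<lambda>Q. act Q (x - y))"
    if "continuous_on SO (\<lambda>Q. act Q x)" "continuous_on SO (\<lambda>Q. act Q y)"
    by (rule continuous_on_eq [OF continuous_on_diff [OF that]]) (simp add: act_simps)
  moreover have "continuous_on SO (\<lambda>Q. act Q (r *\<^sub>R x))" if "continuous_on SO (\<lambda>Q. act Q x)"
    by (rule continuous_on_eq [OF continuous_on_scaleR [OF continuous_on_const [of SO r] that]])
      (simp add: act_simps)
  ultimately show "x \<in> continuous_vectors \<Longrightarrow> y \<in> continuous_vectors \<Longrightarrow> x + y \<in> continuous_vectors"
    "x \<in> continuous_vectors \<Longrightarrow> y \<in> continuous_vectors \<Longrightarrow> x - y \<in> continuous_vectors"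
    "x \<in> continuous_vectors \<Longrightarrow> r *\<^sub>R x \<in> continuous_vectors"
    by (auto simp: continuous_vectors_def)
qed

lemma continuous_vectors_act:
  assumes "x \<in> continuous_vectors" "P \<in> SO"
  shows "act P x \<in> continuous_vectors"
proof -
  have "continuous_on SO (\<lambda>Q. act (Q ** P) x)"
  proof (rule continuous_on_compose2 [of SO "\<lambda>Q. act Q x" SO "\<lambda>Q. Q ** P"])
    show "continuous_on SO (\<lambda>Q. Q ** P)"
      unfolding matrix_matrix_mult_def by (intro continuous_intros)
  qed (use assms in \<open>auto simp: continuous_vectors_def SO_mul\<close>)
  then have "continuous_on SO (\<lambda>Q. act Q (act P x))"
    by (rule continuous_on_eq) (simp add: act_mul assms(2))
  then show ?thesis
    by (simp add: continuous_vectors_def)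
qed

lemma continuous_vectors_proj:
  assumes "x \<in> continuous_vectors" "a \<noteq> 0"
  shows "proj a x \<in> continuous_vectors"
proof -
  obtain b c where "orthogonal_triple a b c"
    using triple_exists assms(2) by blast
  then show ?thesis
    using assms
    by (simp add: proj_triple triple_projection_def orthogonal_triple_def continuous_vectors_simps
        continuous_vectors_act half_turn_SO)
qed

lemma continuous_on_spherical:
  assumes "y \<in> continuous_vectors"
  shows "continuous_on {-1..1} (\<lambda>t. spherical t y)"
proof -
  have "linear (proj p)"
    by (intro linearI) (simp_all add: proj_simps pq_nonzero)
  moreover have "continuous_on {-1..1} (\<lambda>t. act (rot t) y)"
    by (rule continuous_on_compose2 [of SO "\<lambda>Q. act Q y" "{-1..1}" rot])
      (use assms continuous_on_rot in \<open>auto simp: continuous_vectors_def intro!: rot_SO\<close>)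
  ultimately show ?thesis
    unfolding spherical_def
    by (intro continuous_on_compose2 [OF linear_continuous_on [of "proj p" UNIV]])
      (simp_all add: linear_linear)
qed

text \<open>Rational numbers approximate \<open>t\<close> from below, and the spherical function is continuous on vectors with
  continuous orbit map.\<close>

lemma spherical_identity:
  assumes y: "y \<in> line_space p" "y \<in> continuous_vectors" and "\<bar>t\<bar> \<le> 1"
  shows "spherical t y = t *\<^sub>R y"
proof -
  have nonneg: "spherical t y = t *\<^sub>R y" if t: "0 \<le> t" "t \<le> 1" for t
  proof -
    define j where "j N = nat \<lfloor>real (Suc N) * t\<rfloor>" for N
    define r where "r N = real (j N) / real (Suc N)" for N
    have j_le: "j N \<le> Suc N" for N
      using t by (simp add: j_def nat_le_iff floor_le_iff)
        (smt (verit) mult_left_le of_nat_0_le_iff)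
    have j_bounds: "real (j N) \<le> real (Suc N) * t" "real (Suc N) * t \<le> real (j N) + 1" for N
      using t by (simp_all add: j_def of_nat_nat)
    have bound: "norm (r N - t) \<le> inverse (real (Suc N))" for N
    proof -
      have "r N \<le> t"
        using j_bounds(1) [of N] by (simp add: r_def divide_le_eq mult.commute del: of_nat_Suc)
      moreover have "t \<le> (real (j N) + 1) / real (Suc N)"
        using j_bounds(2) [of N] by (simp add: le_divide_eq mult.commute del: of_nat_Suc)
      then have "t \<le> r N + inverse (real (Suc N))"
        by (simp add: r_def add_divide_distrib inverse_eq_divide del: of_nat_Suc)
      ultimately show ?thesis by simp
    qed
    have "(\<lambda>N. r N - t) \<longlonglongrightarrow> 0"
      by (rule Lim_null_comparison [OF _ LIMSEQ_inverse_real_of_nat]) (use bound in auto)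
    then have lim: "r \<longlonglongrightarrow> t"
      by (simp add: LIM_zero_iff)
    have r_range: "r N \<in> {-1..1}" for N
    proof -
      have "0 \<le> r N" "r N \<le> 1"
        using j_le [of N] by (simp_all add: r_def divide_le_eq_1 del: of_nat_Suc)
      then show ?thesis by simp
    qed
    have "(\<lambda>N. spherical (r N) y) \<longlonglongrightarrow> spherical t y"
      by (rule continuous_on_tendsto_compose [OF continuous_on_spherical [OF y(2)] lim])
        (use t r_range in auto)
    moreover have "spherical (r N) y = r N *\<^sub>R y" for N
      unfolding r_def using j_le by (intro spherical_rational y(1)) auto
    moreover have "(\<lambda>N. r N *\<^sub>R y) \<longlonglongrightarrow> t *\<^sub>R y"
      using lim by (intro tendsto_intros)
    ultimately show ?thesis
      using LIMSEQ_unique by simp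
  qed
  show ?thesis
  proof (cases "0 \<le> t")
    case True
    then show ?thesis using nonneg assms(3) by simp
  next
    case False
    then show ?thesis
      using nonneg [of "- t"] spherical_minus [OF y(1), of "- t"] assms(3) by simp
  qed
qed

lemma transport_preimage:
  assumes "x \<in> continuous_vectors" "a \<bullet> a = 1"
  obtains y where "y \<in> line_space p" "y \<in> continuous_vectors" "proj a x = transport a y"
proof -
  obtain Q where Q: "Q \<in> SO" "Q *v p = a"
    using mover_exists assms(2) by blast
  have a0: "a \<noteq> 0" using assms(2) by auto
  define y where "y = act (transpose Q) (proj a x)"
  have "transpose Q *v a = p"
    using Q orthogonal_matrix_cancel(3) [OF SO_orthogonal] by metis
  then have "proj p y = y"
    using act_proj [OF SO_transpose [OF Q(1)] a0, of "proj a x"] by (simp add: y_def proj_idem a0)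
  then have y: "y \<in> line_space p"
    by (simp add: line_space_def)
  moreover have "proj a x = transport a y"
    using transport_eq [OF y Q] Q(1) by (simp add: y_def act_inverse)
  moreover have "y \<in> continuous_vectors"
    using assms(1) Q(1) a0
    by (simp add: y_def continuous_vectors_act continuous_vectors_proj SO_transpose)
  ultimately show ?thesis using that by blast
qed

text \<open>A unit combination of the frame vectors lies in the plane of \<open>w j\<close> and the normalized combination
  \<open>b\<close> of the others, so the statement reduces to the two-dimensional case. If the other coefficients
  vanish, any unit vector orthogonal to \<open>w j\<close> can serve as \<open>b\<close>.\<close>

lemma proj_orthonormal_combination:
  fixes w :: "'i \<Rightarrow> real^'n"
  assumes "finite I" and x: "x \<in> continuous_vectors"
    and "\<And>i j. i \<in> I \<Longrightarrow> j \<in> I \<Longrightarrow> w i \<bullet> w j = (if i = j then 1 else 0)"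
    and "\<And>i. i \<in> I \<Longrightarrow> y i \<in> line_space p" "\<And>i. i \<in> I \<Longrightarrow> y i \<in> continuous_vectors"
    and "\<And>i. i \<in> I \<Longrightarrow> proj (w i) x = transport (w i) (y i)"
    and "(\<Sum>i\<in>I. (c i)\<^sup>2) = 1"
  shows "proj (\<Sum>i\<in>I. c i *\<^sub>R w i) x = transport (\<Sum>i\<in>I. c i *\<^sub>R w i) (\<Sum>i\<in>I. c i *\<^sub>R y i)"
  using assms(1,3-)
proof (induction I arbitrary: c rule: finite_induct)
  case empty
  then show ?case by simp
next
  case (insert j I)
  have w: "w i \<bullet> w l = (if i = l then 1 else 0)" if "i \<in> I" "l \<in> I" for i l
    using insert.prems(1) that by blast
  have wj: "w i \<bullet> w j = 0" if "i \<in> I" for i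
    using insert.prems(1) [of i j] that insert.hyps(2) by auto
  have unit_j: "w j \<bullet> w j = 1"
    using insert.prems(1) [of j j] by simp
  define \<gamma> where "\<gamma> = sqrt (\<Sum>i\<in>I. (c i)\<^sup>2)"
  have \<gamma>: "\<gamma>\<^sup>2 = (\<Sum>i\<in>I. (c i)\<^sup>2)"
    by (simp add: \<gamma>_def sum_nonneg)
  have total: "\<gamma>\<^sup>2 + (c j)\<^sup>2 = 1"
    using insert.prems(5) insert.hyps \<gamma> by simp
  then have small: "\<bar>\<gamma>\<bar> \<le> 1" "\<bar>c j\<bar> \<le> 1"
    by (simp_all add: abs_square_le_1 [symmetric]) (smt (verit) zero_le_power2)+
  obtain b z where b: "b \<bullet> b = 1" "b \<bullet> w j = 0" "\<gamma> *\<^sub>R b = (\<Sum>i\<in>I. c i *\<^sub>R w i)"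
    and z: "z \<in> line_space p" "z \<in> continuous_vectors" "proj b x = transport b z"
      "\<gamma> *\<^sub>R z = (\<Sum>i\<in>I. c i *\<^sub>R y i)"
  proof (cases "\<gamma> = 0")
    case True
    then have c0: "c i = 0" if "i \<in> I" for i
      using \<gamma> that insert.hyps(1) by (simp add: sum_nonneg_eq_0_iff)
    obtain b where b: "b \<bullet> b = 1" "w j \<bullet> b = 0" "b \<bullet> w j = 0"
      using orthogonal_to_few [of "[w j]"] by auto
    then obtain z where "z \<in> line_space p" "z \<in> continuous_vectors" "proj b x = transport b z"
      using transport_preimage [OF x] by blast
    then show ?thesis
      using that [of b z] b True c0 by simp
  next
    case False
    define b where "b = (\<Sum>i\<in>I. (c i / \<gamma>) *\<^sub>R w i)"
    define z where "z = (\<Sum>i\<in>I. (c i / \<gamma>) *\<^sub>R y i)"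
    have normalized: "(\<Sum>i\<in>I. (c i / \<gamma>)\<^sup>2) = 1"
      using False by (simp add: power_divide \<gamma> [symmetric] flip: sum_divide_distrib)
    have "proj b x = transport b z"
      unfolding b_def z_def
      by (rule insert.IH) (use insert.prems normalized in auto)
    moreover have "b \<bullet> b = (\<Sum>i\<in>I. (c i / \<gamma>)\<^sup>2)"
    proof -
      have w_b: "w i \<bullet> b = c i / \<gamma>" if "i \<in> I" for i
      proof -
        have "w i \<bullet> b = (\<Sum>l\<in>I. (c l / \<gamma>) * (w i \<bullet> w l))"
          by (simp add: b_def inner_sum_right)
        also have "\<dots> = (\<Sum>l\<in>I. if l = i then c i / \<gamma> else 0)"
          using that by (intro sum.cong) (auto simp: w)
        finally show ?thesis
          using insert.hyps(1) that by simp
      qed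
      have "b \<bullet> b = (\<Sum>i\<in>I. (c i / \<gamma>) * (w i \<bullet> b))"
        by (subst (1) b_def) (simp only: inner_sum_left inner_scaleR_left)
      then show ?thesis
        using w_b by (simp add: power2_eq_square)
    qed
    moreover have "b \<bullet> w j = 0"
      by (simp add: b_def inner_sum_left wj)
    moreover have "\<gamma> *\<^sub>R b = (\<Sum>i\<in>I. c i *\<^sub>R w i)" "\<gamma> *\<^sub>R z = (\<Sum>i\<in>I. c i *\<^sub>R y i)"
      using False by (simp_all add: b_def z_def scaleR_sum_right)
    moreover have "z \<in> line_space p"
      unfolding z_def using insert.prems(2) by (intro line_space_simps pq_nonzero) auto
    moreover have "z \<in> continuous_vectors"
    proof -
      have "0 \<in> continuous_vectors"
        using continuous_vectors_simps(3) [OF x, of 0] by simp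
      moreover have "(c i / \<gamma>) *\<^sub>R y i \<in> continuous_vectors" if "i \<in> I" for i
        using insert.prems(3) that by (intro continuous_vectors_simps) auto
      ultimately show ?thesis
        unfolding z_def
        by (intro subspace_sum) (auto simp: subspace_def continuous_vectors_simps)
    qed
    ultimately show ?thesis
      using that [of b z] normalized by simp
  qed
  have "proj (\<gamma> *\<^sub>R b + c j *\<^sub>R w j) x
      = transport (\<gamma> *\<^sub>R b + c j *\<^sub>R w j) (spherical \<gamma> z + spherical (c j) (y j))"
    by (rule proj_plane_transport) (use b z unit_j total insert.prems in auto)
  also have "spherical \<gamma> z + spherical (c j) (y j) = \<gamma> *\<^sub>R z + c j *\<^sub>R y j"
    using spherical_identity z small insert.prems by simp
  finally show ?case
    using b z insert.hyps by (simp add: add.commute)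
qed

end

section \<open>The lower bound for the ambient dimension\<close>

context degenerate_SO_representation
begin

text \<open>A stabilizer argument shows that the components of the image of a frame in the \<open>k\<close> frame directions
  are independent; orthogonality of the projections for the \<open>n\<close> coordinate directions multiplies their
  number by \<open>n\<close>.\<close>

lemma embedding_dimension_bound:
  fixes \<epsilon> :: "real^'n^'k \<Rightarrow> 'v"
  assumes emb: "SO_equivariant_embedding act \<epsilon>" and card: "CARD('k) + 2 \<le> CARD('n)"
  shows "CARD('n) * CARD('k) \<le> DIM('v)"
proof -
  obtain p :: "real^'n" where p: "p \<bullet> p = 1"
    using orthogonal_to_few [of "[]"] by auto
  obtain q where q: "q \<bullet> q = 1" "p \<bullet> q = 0" "q \<bullet> p = 0"
    using orthogonal_to_few [of "[p]"] by auto
  interpret pointed_degenerate_SO_representation act p q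
    by unfold_locales (use p q in auto)
  have equi: "\<epsilon> (frame_act Q w) = act Q (\<epsilon> w)" if "Q \<in> SO" "w \<in> stiefel" for Q w
    using emb that by (simp add: SO_equivariant_embedding_def)
  obtain w :: "real^'n^'k" where w: "w \<in> stiefel"
    using stiefel_nonempty card by force
  then have orthonormal: "w $ i \<bullet> w $ j = (if i = j then 1 else 0)" for i j
    by (simp add: stiefel_def)
  define v where "v = \<epsilon> w"
  have v: "v \<in> continuous_vectors"
  proof -
    have "continuous_on SO (\<lambda>Q. \<epsilon> (frame_act Q w))"
    proof (rule continuous_on_compose2 [OF embedding_continuous [OF emb]])
      show "continuous_on SO (\<lambda>Q. frame_act Q w)"
        unfolding frame_act_def matrix_vector_mult_def by (intro continuous_intros)
    qed (use w frame_act_stiefel in auto)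
    then have "continuous_on SO (\<lambda>Q. act Q v)"
      by (rule continuous_on_eq) (simp add: equi w v_def)
    then show ?thesis by (simp add: continuous_vectors_def)
  qed
  have "\<exists>y. y \<in> line_space p \<and> y \<in> continuous_vectors \<and> proj (w $ i) v = transport (w $ i) y" for i
  proof -
    have "w $ i \<bullet> w $ i = 1"
      by (simp add: orthonormal)
    then show ?thesis
      by (rule transport_preimage [OF v]) blast
  qed
  then obtain y where y: "\<And>i. y i \<in> line_space p" "\<And>i. y i \<in> continuous_vectors"
      "\<And>i. proj (w $ i) v = transport (w $ i) (y i)"
    by metis
  have independent_y: "c j = 0" if c: "(\<Sum>i\<in>UNIV. c i *\<^sub>R y i) = 0" for c j
  proof (rule ccontr)
    assume "c j \<noteq> 0"
    \<comment> \<open>The normalized relation gives a unit vector \<open>a\<close> in the span of the frame in whose direction \<open>v\<close>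
      has no component.\<close>
    define \<gamma> where "\<gamma> = sqrt (\<Sum>i\<in>UNIV. (c i)\<^sup>2)"
    have \<gamma>2: "\<gamma>\<^sup>2 = (\<Sum>i\<in>UNIV. (c i)\<^sup>2)"
      by (simp add: \<gamma>_def sum_nonneg)
    have \<gamma>0: "\<gamma> \<noteq> 0"
      using \<open>c j \<noteq> 0\<close> by (auto simp: \<gamma>_def sum_nonneg_eq_0_iff)
    define d where "d i = c i / \<gamma>" for i
    have unit_d: "(\<Sum>i\<in>UNIV. (d i)\<^sup>2) = 1"
      using \<gamma>0 by (simp add: d_def power_divide \<gamma>2 [symmetric] flip: sum_divide_distrib)
    have "(\<Sum>i\<in>UNIV. d i *\<^sub>R y i) = (1 / \<gamma>) *\<^sub>R (\<Sum>i\<in>UNIV. c i *\<^sub>R y i)"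
      by (simp add: d_def scaleR_sum_right)
    then have zero: "(\<Sum>i\<in>UNIV. d i *\<^sub>R y i) = 0"
      using c by simp
    define a where "a = (\<Sum>i\<in>UNIV. d i *\<^sub>R w $ i)"
    have w_a: "w $ i \<bullet> a = d i" for i
    proof -
      have "w $ i \<bullet> a = (\<Sum>l\<in>UNIV. d l * (w $ i \<bullet> w $ l))"
        by (simp add: a_def inner_sum_right)
      also have "\<dots> = (\<Sum>l\<in>UNIV. if l = i then d i else 0)"
        by (intro sum.cong) (auto simp: orthonormal)
      finally show ?thesis by simp
    qed
    have "a \<bullet> a = (\<Sum>i\<in>UNIV. d i * (w $ i \<bullet> a))"
      by (subst (1) a_def) (simp only: inner_sum_left inner_scaleR_left)
    then have a1: "a \<bullet> a = 1"
      using unit_d by (simp add: w_a power2_eq_square)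
    have "proj a v = transport a (\<Sum>i\<in>UNIV. d i *\<^sub>R y i)"
      unfolding a_def
      by (rule proj_orthonormal_combination) (use v y orthonormal unit_d in auto)
    then have proj_a: "proj a v = 0"
      using zero transport_simps(4) [OF y(1) y(1) a1] by simp
    \<comment> \<open>The vector \<open>v\<close> has no component in a direction \<open>b\<close> orthogonal to the frame either: it is fixed
      by a half-turn that fixes the frame and reverses \<open>b\<close>. Two such directions exist because
      \<open>k + 2 \<le> n\<close>.\<close>
    have "card (range (($) w)) < CARD('n)"
      using card_image_le [of UNIV "($) w"] card by simp
    then obtain b where "norm b = 1" "\<forall>x\<in>range (($) w). x \<bullet> b = 0"
      using orthogonal_vector_exists [of "range (($) w)"] by auto
    then have b: "b \<noteq> 0" "\<And>i. w $ i \<bullet> b = 0" "\<And>i. b \<bullet> w $ i = 0"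
      by (auto simp: inner_commute)
    have "card (insert b (range (($) w))) < CARD('n)"
      using card_image_le [of UNIV "($) w"] card card_insert_le_m1
      by (simp add: card_insert_if)
    then obtain b' where "norm b' = 1" "\<forall>x\<in>insert b (range (($) w)). x \<bullet> b' = 0"
      using orthogonal_vector_exists [of "insert b (range (($) w))"] by auto
    then have b': "b' \<noteq> 0" "\<And>i. b' \<bullet> w $ i = 0" "b \<bullet> b' = 0"
      by (auto simp: inner_commute)
    have "frame_act (half_turn b b') w = w"
      by (simp add: frame_act_def vec_eq_iff [of _ w] matrix_vector_mul_assoc [symmetric]
          reflection_orthogonal_vector b b')
    then have "turn b b' v = v"
      using equi [of "half_turn b b'" w] b b' w by (simp add: half_turn_SO v_def)
    then have "proj b v + proj b' v = 0"
      using diff_turn_eq_proj [of b b' v] b b' by simp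
    then have "proj b (proj b v + proj b' v) = 0"
      using b by (simp add: proj_simps)
    then have proj_b: "proj b v = 0"
      using b b' by (simp add: proj_simps proj_idem proj_orthogonal)
    \<comment> \<open>So the half-turn in the plane of \<open>a\<close> and \<open>b\<close> fixes \<open>v\<close>, hence the frame, although it reverses \<open>a\<close>.\<close>
    have ab: "a \<noteq> 0" "a \<bullet> b = 0" "b \<bullet> a = 0"
    proof -
      show "a \<noteq> 0" using a1 by auto
      show "a \<bullet> b = 0" "b \<bullet> a = 0"
        using b by (simp_all add: a_def inner_sum_left inner_sum_right)
    qed
    then have "turn a b v = v"
      using diff_turn_eq_proj [of a b v] b proj_a proj_b by simp
    then have "\<epsilon> (frame_act (half_turn a b) w) = \<epsilon> w"
      using equi [of "half_turn a b" w] ab b w by (simp add: half_turn_SO v_def)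
    then have "frame_act (half_turn a b) w = w"
      using inj_onD [OF embedding_inj [OF emb]] frame_act_stiefel half_turn_SO ab(1) b(1) w by blast
    then have "half_turn a b *v (w $ j) = w $ j"
      by (simp add: frame_act_def vec_eq_iff)
    then have "(half_turn a b *v (w $ j)) \<bullet> a = d j"
      by (simp add: w_a)
    moreover have "(half_turn a b *v (w $ j)) \<bullet> a = - d j"
      using a1 b by (simp add: matrix_vector_mul_assoc [symmetric] reflection_orthogonal_vector
          reflection_apply [of a] inner_diff_left inner_commute [of a "w $ j"] w_a)
    ultimately have "d j = 0" by simp
    then show False
      using \<open>c j \<noteq> 0\<close> \<gamma>0 by (simp add: d_def)
  qed
  let ?e = "\<lambda>i. axis i 1 :: real^'n"
  have e: "?e i \<bullet> ?e i = 1" "?e i \<noteq> 0" for i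
    by (simp_all add: inner_axis_axis)
  define x where "x = (\<lambda>(i, j). transport (?e i) (y j))"
  have "card (UNIV :: ('n \<times> 'k) set) \<le> DIM('v)"
  proof (rule independent_family_card)
    fix u :: "'n \<times> 'k \<Rightarrow> real"
    assume "(\<Sum>l\<in>UNIV. u l *\<^sub>R x l) = 0"
    then have sum: "(\<Sum>i\<in>UNIV. \<Sum>j\<in>UNIV. u (i, j) *\<^sub>R x (i, j)) = 0"
      by (simp add: sum.cartesian_product)
    have block: "(\<Sum>j\<in>UNIV. u (i, j) *\<^sub>R x (i, j)) = transport (?e i) (\<Sum>j\<in>UNIV. u (i, j) *\<^sub>R y j)"
      for i
    proof -
      have "transport (?e i) (\<Sum>j\<in>J. u (i, j) *\<^sub>R y j) = (\<Sum>j\<in>J. u (i, j) *\<^sub>R x (i, j))"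
        if "finite J" for J :: "'k set"
        using that
      proof (induction J)
        case empty
        then show ?case
          using transport_simps(4) [OF y(1) y(1) e(1)] by simp
      next
        case (insert j J)
        have "u (i, j) *\<^sub>R y j \<in> line_space p" "(\<Sum>j\<in>J. u (i, j) *\<^sub>R y j) \<in> line_space p"
          by (auto intro!: line_space_simps pq_nonzero y)
        then show ?case
          using insert transport_simps [OF _ _ e(1)] y(1) by (simp add: x_def)
      qed
      then show ?thesis by simp
    qed
    have sum_in: "(\<Sum>j\<in>UNIV. u (i, j) *\<^sub>R y j) \<in> line_space p" for i
      by (intro line_space_simps pq_nonzero y)
    have "(\<Sum>j\<in>UNIV. u (i, j) *\<^sub>R y j) = 0" for i
    proof -
      have "proj (?e i) (transport (?e l) (\<Sum>j\<in>UNIV. u (l, j) *\<^sub>R y j))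
          = (if l = i then transport (?e i) (\<Sum>j\<in>UNIV. u (i, j) *\<^sub>R y j) else 0)" for l
      proof -
        have "proj (?e l) (transport (?e l) (\<Sum>j\<in>UNIV. u (l, j) *\<^sub>R y j))
            = transport (?e l) (\<Sum>j\<in>UNIV. u (l, j) *\<^sub>R y j)"
          using transport_in [OF sum_in e(1)] by (simp add: line_space_def)
        moreover have "proj (?e i) (proj (?e l) z) = 0" if "l \<noteq> i" for z
          using that by (intro proj_orthogonal e) (simp add: inner_axis_axis)
        ultimately show ?thesis by metis
      qed
      then have "proj (?e i) (\<Sum>l\<in>UNIV. transport (?e l) (\<Sum>j\<in>UNIV. u (l, j) *\<^sub>R y j))
          = transport (?e i) (\<Sum>j\<in>UNIV. u (i, j) *\<^sub>R y j)"
        by (simp add: proj_simps e)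
      then have "transport (?e i) (\<Sum>j\<in>UNIV. u (i, j) *\<^sub>R y j) = 0"
        using sum by (simp only: block proj_simps(4) [OF e(2)])
      then have "transport (?e i) (\<Sum>j\<in>UNIV. u (i, j) *\<^sub>R y j) = transport (?e i) 0"
        using transport_simps(4) [OF y(1) y(1) e(1)] by simp
      then show ?thesis
        using transport_simps(3) [OF sum_in _ e(1)] line_space_simps(1) [OF pq_nonzero(1)] by blast
    qed
    then show "\<forall>l\<in>UNIV. u l = 0"
      using independent_y by (metis surj_pair)
  qed simp
  then show ?thesis by simp
qed

end

text \<open>If the bound failed, the dimension would be below \<open>n k \<le> n (n - 2) / 2 < n choose 2\<close>, and then
  half-turns are degenerate.\<close>

lemma ambient_dimension_bound:
  fixes act :: "real^'n^'n \<Rightarrow> 'v::euclidean_space \<Rightarrow> 'v" and \<epsilon> :: "real^'n^'k \<Rightarrow> 'v"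
  assumes emb: "SO_equivariant_embedding act \<epsilon>" and "17 \<le> CARD('n)" "2 * CARD('k) + 2 \<le> CARD('n)"
  shows "CARD('n) * CARD('k) \<le> DIM('v)"
proof (rule ccontr)
  assume small_dim: "\<not> CARD('n) * CARD('k) \<le> DIM('v)"
  interpret SO_representation act
    using emb by unfold_locales (simp add: SO_equivariant_embedding_def)
  have "2 * (CARD('n) * CARD('k)) \<le> CARD('n) * (CARD('n) - 1)"
    using assms(3) by (simp add: mult.left_commute [of 2])
  also have "\<dots> = 2 * (CARD('n) choose 2)"
    using times_binomial_minus1_eq [of 2 "CARD('n)"] by simp
  finally have small: "DIM('v) < CARD('n) choose 2"
    using small_dim by linarith
  interpret degenerate_SO_representation act
    by unfold_locales (use turns_degenerate [OF small assms(2)] assms(2) in auto)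
  show False
    using embedding_dimension_bound [OF emb] assms small_dim by simp
qed

theorem proposition6p1:
  assumes "CARD('k::finite) < CARD('n::finite)"
  shows
    "(\<forall>\<epsilon> :: real^'n^'k \<Rightarrow> real^'k^'n.
        SO_equivariant_embedding (**) \<epsilon> \<longrightarrow>
        (\<exists>A\<in>sym_pos_def. \<epsilon> ` stiefel = stiefel_model A)) \<and>
     (CARD('n) \<ge> 17 \<and> real CARD('k) < (real CARD('n) - 1) / 2 \<longrightarrow>
        (\<forall>A :: real^'k^'k. A \<in> sym_pos_def \<longrightarrow>
           SO_equivariant_stiefel_model TYPE('k)
             ((**) :: real^'n^'n \<Rightarrow> real^'k^'n \<Rightarrow> real^'k^'n) (stiefel_model A) \<and>
           (\<forall>(act :: real^'n^'n \<Rightarrow> 'v::euclidean_space \<Rightarrow> 'v) M.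
              SO_equivariant_stiefel_model TYPE('k) act M \<longrightarrow>
              DIM(real^'k^'n) \<le> DIM('v))))"
proof (intro conjI allI impI)
  fix \<epsilon> :: "real^'n^'k \<Rightarrow> real^'k^'n"
  assume "SO_equivariant_embedding (**) \<epsilon>"
  then show "\<exists>A\<in>sym_pos_def. \<epsilon> ` stiefel = stiefel_model A"
    by (rule equivariant_image [OF assms])
next
  fix A :: "real^'k^'k"
  assume "A \<in> sym_pos_def"
  then show "SO_equivariant_stiefel_model TYPE('k)
      ((**) :: real^'n^'n \<Rightarrow> real^'k^'n \<Rightarrow> real^'k^'n) (stiefel_model A)"
    by (rule stiefel_model_is_model)
next
  fix act :: "real^'n^'n \<Rightarrow> 'v::euclidean_space \<Rightarrow> 'v" and M
  assume n: "CARD('n) \<ge> 17 \<and> real CARD('k) < (real CARD('n) - 1) / 2"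
    and "SO_equivariant_stiefel_model TYPE('k) act M"
  then obtain \<epsilon> :: "real^'n^'k \<Rightarrow> 'v" where "SO_equivariant_embedding act \<epsilon>"
    by (auto simp: SO_equivariant_stiefel_model_def)
  moreover have "2 * CARD('k) + 2 \<le> CARD('n)"
  proof -
    have "2 * real CARD('k) + 1 < real CARD('n)"
      using n by (simp add: field_simps)
    then show ?thesis by linarith
  qed
  ultimately show "DIM(real^'k^'n) \<le> DIM('v)"
    using ambient_dimension_bound n by (simp add: mult.commute)
qed

end
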